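(* Let $N\ge 3$ be an integer and let $p$ be a real number with $1<p\le N-1$. For $j=1,2$ let $a_j,h_j:[0,\infty)\to[0,\infty)$ be continuous functions, none of them identically zero, regarded as radial functions $x\mapsto a_j(|x|)$, $x\mapsto h_j(|x|)$ on $\mathbb{R}^N$. For $j=1,2$ let $f_j:[0,\infty)^2\to[0,\infty)$ be continuous, nondecreasing in each variable, and such that $f_j(s_1,s_2)>0$ whenever $s_i>0$ for some $i\in\{1,2\}$. Put $$F(s):=\int_0^s\bigl(f_1(t,t)+f_2(t,t)\bigr)\,dt,$$ and assume that, for some $a>0$, $$\lim_{r\to\infty}\int_a^r [F(s)]^{-1/p}\,ds=\infty .$$ Consider the system $$\Delta_p u_j+h_j(|x|)\,|\nabla u_j|^{p-1}=a_j(|x|)\,f_j(u_1,u_2)\quad\text{on }\mathbb{R}^N,\qquad j=1,2. \qquad ( * )$$ Then $( * )$ has infinitely many positive entire radial solutions $(u_1,u_2)$. Suppose furthermore that the function $$r\mapsto r^{\frac{p(N-1)}{p-1}}\sum_{j=1}^{2}e^{\frac{p}{p-1}\int_0^r h_j(\tau)\,d\tau}\,a_j(r)$$ is nondecreasing for all sufficiently large $r$. Then: (i) the positive entire radial solutions of $( * )$ are bounded if there exists $\varepsilon>0$ such that $$\int_0^\infty t^{1+\varepsilon}\Bigl(\sum_{j=1}^{2}e^{\frac{p}{p-1}\int_0^t h_j(\tau)\,d\tau}\,a_j(t)\Bigr)^{2/p}dt<\infty ;$$ (ii) the positive entire radial solutions of $( * )$ are large if, for both $j=1$ and $j=2$,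 $$\int_0^\infty\left(\frac{e^{-\int_0^t h_j(\tau)\,d\tau}}{t^{N-1}}\int_0^t s^{N-1}e^{\int_0^s h_j(\tau)\,d\tau}\,a_j(s)\,ds\right)^{1/(p-1)}dt=\infty .$$
   Context: $|x|$ is the Euclidean norm on $\mathbb{R}^N$, and $\Delta_p u:=\operatorname{div}(|\nabla u|^{p-2}\nabla u)$ is the $p$-Laplace operator. A positive entire radial solution of the system is a pair $(u_1,u_2)$ of functions $u_j\in C^1([0,\infty))$ with $u_j>0$ on $[0,\infty)$, $u_j'(0)=0$, such that $x\mapsto u_j(|x|)$ solve the system on all of $\mathbb{R}^N$. In radial form this means that $r\mapsto r^{N-1}|u_j'(r)|^{p-2}u_j'(r)$ is continuously differentiable on $(0,\infty)$ and, for all $r>0$ and $j=1,2$, $$\bigl(r^{N-1}|u_j'(r)|^{p-2}u_j'(r)\bigr)'+r^{N-1}h_j(r)|u_j'(r)|^{p-1}=r^{N-1}a_j(r)f_j(u_1(r),u_2(r)).$$ A solution $(u_1,u_2)$ is bounded if both $u_1$ and $u_2$ are bounded functions; it is large if $\lim_{r\to\infty}u_j(r)=\infty$ for both $j=1,2$. *)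

theory Defs
  imports "HOL-Analysis.Analysis"
begin

text \<open>
  A radial function on \<open>\<real>\<^sup>N\<close> is represented by its profile, a function \<open>real \<Rightarrow> real\<close> of which only
  the values on \<open>{0..}\<close> matter.

  The predicate says that \<open>u\<close> is a positive profile in \<open>C\<^sup>1([0,\<infinity>))\<close> with \<open>u'(0) = 0\<close> solving
  \<open>(r\<^sup>N\<^sup>-\<^sup>1 |u'|\<^sup>p\<^sup>-\<^sup>2 u')' + r\<^sup>N\<^sup>-\<^sup>1 h |u'|\<^sup>p\<^sup>-\<^sup>1 = r\<^sup>N\<^sup>-\<^sup>1 g\<close> for \<open>r > 0\<close>, i.e. the radial form of
  \<open>\<Delta>\<^sub>p u + h |\<nabla>u|\<^sup>p\<^sup>-\<^sup>1 = g\<close> on \<open>\<real>\<^sup>N\<close>.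
  Here \<open>v = u'\<close> (one-sided at 0) and \<open>q\<close> is the derivative of the flux; both are uniquely determined
  on their domains.  Since \<open>0 powr b = 0\<close>, the flux is 0 wherever \<open>u' = 0\<close>, also for \<open>p \<le> 2\<close>.
\<close>

definition positive_radial_solution ::
  "nat \<Rightarrow> real \<Rightarrow> (real \<Rightarrow> real) \<Rightarrow> (real \<Rightarrow> real) \<Rightarrow> (real \<Rightarrow> real) \<Rightarrow> bool" where
  "positive_radial_solution N p h g u \<longleftrightarrow>
     (\<forall>r\<ge>0. u r > 0) \<and>
     (\<exists>v. (\<forall>r\<ge>0. (u has_real_derivative v r) (at r within {0..})) \<and>
          continuous_on {0..} v \<and> v 0 = 0 \<and>
          (\<exists>q. (\<forall>r>0. ((\<lambda>s. s ^ (N - 1) * \<bar>v s\<bar> powr (p - 2) * v s)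
                         has_real_derivative q r) (at r)) \<and>
               continuous_on {0<..} q \<and>
               (\<forall>r>0. q r + r ^ (N - 1) * h r * \<bar>v r\<bar> powr (p - 1) = r ^ (N - 1) * g r)))"

text \<open>The data of the two equations are families \<open>h j\<close>, \<open>a j\<close>, \<open>f j\<close>, used for \<open>j = 1, 2\<close> only.\<close>

definition positive_entire_radial_solution ::
  "nat \<Rightarrow> real \<Rightarrow> (nat \<Rightarrow> real \<Rightarrow> real) \<Rightarrow> (nat \<Rightarrow> real \<Rightarrow> real) \<Rightarrow> (nat \<Rightarrow> real \<times> real \<Rightarrow> real) \<Rightarrow>
   (real \<Rightarrow> real) \<Rightarrow> (real \<Rightarrow> real) \<Rightarrow> bool" where
  "positive_entire_radial_solution N p h a f u1 u2 \<longleftrightarrow>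
     positive_radial_solution N p (h 1) (\<lambda>r. a 1 r * f 1 (u1 r, u2 r)) u1 \<and>
     positive_radial_solution N p (h 2) (\<lambda>r. a 2 r * f 2 (u1 r, u2 r)) u2"

definition bounded_pair :: "(real \<Rightarrow> real) \<Rightarrow> (real \<Rightarrow> real) \<Rightarrow> bool" where
  "bounded_pair u1 u2 \<longleftrightarrow> bounded (u1 ` {0..}) \<and> bounded (u2 ` {0..})"

definition large_pair :: "(real \<Rightarrow> real) \<Rightarrow> (real \<Rightarrow> real) \<Rightarrow> bool" where
  "large_pair u1 u2 \<longleftrightarrow> filterlim u1 at_top at_top \<and> filterlim u2 at_top at_top"

text \<open>Two solutions are the same when they agree on \<open>{0..}\<close>; restricting to \<open>{0..}\<close> discards the
  irrelevant values at negative arguments, which must not be counted.\<close>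

definition positive_entire_radial_solutions ::
  "nat \<Rightarrow> real \<Rightarrow> (nat \<Rightarrow> real \<Rightarrow> real) \<Rightarrow> (nat \<Rightarrow> real \<Rightarrow> real) \<Rightarrow> (nat \<Rightarrow> real \<times> real \<Rightarrow> real) \<Rightarrow>
   ((real \<Rightarrow> real) \<times> (real \<Rightarrow> real)) set" where
  "positive_entire_radial_solutions N p h a f =
     {(restrict u1 {0..}, restrict u2 {0..}) | u1 u2.
        positive_entire_radial_solution N p h a f u1 u2}"

definition primitive_F :: "(nat \<Rightarrow> real \<times> real \<Rightarrow> real) \<Rightarrow> real \<Rightarrow> real" where
  "primitive_F f s = integral {0..s} (\<lambda>t. f 1 (t, t) + f 2 (t, t))"

end

theory Submission
  imports Defs
begin

text \<open>
  Write \<open>H\<^sub>j(r)\<close> for the integral of \<open>h\<^sub>j\<close> over \<open>[0, r]\<close>.  In each equation the gradient term is absorbed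
  by the integrating factor \<open>exp(H\<^sub>j)\<close>, once it is known that \<open>u\<^sub>j' \<ge> 0\<close>.  With the weight
  \<open>P\<^sub>j = r\<^sup>N\<^sup>-\<^sup>1 exp(H\<^sub>j)\<close> and the flux \<open>W\<^sub>j(r)\<close>, the integral of \<open>P\<^sub>j a\<^sub>j f\<^sub>j(u\<^sub>1, u\<^sub>2)\<close> over \<open>[0, r]\<close>,
  the system is therefore equivalent to the first-order equations \<open>u\<^sub>j' = (W\<^sub>j / P\<^sub>j)\<^bsup>1/(p-1)\<^esup>\<close>
  (\<open>positive_radial_solution_of_slope\<close>, \<open>slope_of_positive_radial_solution\<close>, \<open>solution_iff\<close>).
  
  The estimate behind both existence and boundedness is an energy inequality
  (\<open>energy_estimate\<close>).  Put \<open>q = p/(p-1)\<close> and \<open>U = u\<^sub>1 + u\<^sub>2\<close>.  Then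
  \<open>(W\<^sub>j\<^sup>q)' = q P\<^sub>j\<^sup>q a\<^sub>j f\<^sub>j(u\<^sub>1, u\<^sub>2) u\<^sub>j'\<close>, and the product of the last two factors is at most \<open>(F(U))'\<close>, because
  \<open>f\<^sub>j(u\<^sub>1, u\<^sub>2) \<le> f\<^sub>1(U, U) + f\<^sub>2(U, U)\<close> and \<open>u\<^sub>j' \<le> U'\<close>.  If \<open>P\<^sub>j\<^sup>q a\<^sub>j \<le> \<Gamma>\<close> on \<open>[R, r]\<close>, integration
  gives \<open>W\<^sub>j(r)\<^sup>q \<le> W\<^sub>j(R)\<^sup>q + q \<Gamma> F(U(r))\<close>.  Dividing by \<open>P\<^sub>j(r)\<^sup>q\<close> turns this into
  \<open>u\<^sub>j'(r)\<^sup>p \<le> k(r) F(U(r))\<close> with an explicit \<open>k\<close>, hence \<open>U' F(U)\<^bsup>-1/p\<^esup> \<le> 2 k\<^bsup>1/p\<^esup>\<close>.  The variables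
  separate: the integral of \<open>F\<^bsup>-1/p\<^esup>\<close> up to \<open>U(r)\<close> is bounded by an integral of \<open>2 k\<^bsup>1/p\<^esup>\<close>
  (\<open>integral_\<psi>_le\<close>).  As the Keller-Osserman integral diverges, every bound on it is a bound on \<open>U\<close>
  (\<open>bounded_of_integral_\<psi>\<close>).

  \<^bold>\<open>Existence.\<close>  Picard iteration started at the constant pair \<open>(b, b)\<close> increases.  On
  \<open>[0, R]\<close> the energy inequality holds with \<open>\<Gamma> = P\<^sub>j(r)\<^sup>q max a\<^sub>j\<close>, since \<open>P\<^sub>j\<close> is nondecreasing; then \<open>k\<close>
  is a constant and all iterates have a common bound.  Dominated convergence passes to the limit.
  Different \<open>b > 0\<close> give different solutions.

  \<^bold>\<open>Boundedness.\<close>  Under the monotonicity hypothesis \<open>\<Gamma> = r\<^bsup>q(N-1)\<^esup> A(r)\<close> is admissible for large \<open>R\<close>,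
  where \<open>A = \<Sum>\<^sub>j exp(q H\<^sub>j) a\<^sub>j\<close>, so \<open>k = C r\<^bsup>-q(N-1)\<^esup> + q A\<close>.  The root \<open>k\<^bsup>1/p\<^esup>\<close> is integrable at
  infinity: the first term because \<open>(N-1)/(p-1) > 1\<close>, the second because
  \<open>A\<^bsup>1/p\<^esup> \<le> t\<^bsup>-1-\<epsilon>\<^esup> + t\<^bsup>1+\<epsilon>\<^esup> A\<^bsup>2/p\<^esup>\<close>.

  \<^bold>\<open>Largeness.\<close>  Solutions are nondecreasing, so \<open>f\<^sub>j(u\<^sub>1, u\<^sub>2) \<ge> f\<^sub>j(u\<^sub>1(0), u\<^sub>2(0)) > 0\<close>, and \<open>u\<^sub>j'\<close> dominates
  a positive multiple of the integrand that is assumed to have an infinite integral.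
\<close>

section \<open>Calculus on half-lines\<close>

lemma has_real_derivative_integral_atLeast:
  fixes g :: "real \<Rightarrow> real"
  assumes "continuous_on {c..} g" and "c \<le> r"
  shows "((\<lambda>x. integral {c..x} g) has_real_derivative g r) (at r within {c..})"
proof -
  have "((\<lambda>x. integral {c..x} g) has_real_derivative g r) (at r within {c..r+1})"
    by (rule integral_has_real_derivative) (use assms in \<open>auto intro: continuous_on_subset\<close>)
  moreover have "at r within {c..r+1} = at r within {c..}"
    by (rule at_within_nhd[where S="{..<r+1}"]) auto
  ultimately show ?thesis by simp
qed

lemma has_real_derivative_within_atLeast_at:
  fixes u :: "real \<Rightarrow> real"
  assumes "(u has_real_derivative D) (at r within {c..})" and "c < r"
  shows "(u has_real_derivative D) (at r)"
proof -
  have "at r within {c..} = at r"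
    by (rule at_within_interior) (use assms(2) in \<open>simp add: interior_Ici[of "c-1"]\<close>)
  then show ?thesis using assms by simp
qed

text \<open>
  The flux may vanish on an initial interval, so the chain rule for \<open>W\<^sup>q\<close> is needed at \<open>W = 0\<close> too.
  It holds there because \<open>q > 1\<close> and because \<open>powr\<close> is an even function of its real base.
\<close>
lemma has_real_derivative_powr_at_nonneg:
  fixes x q :: real
  assumes "x \<ge> 0" and "q > 1"
  shows "((\<lambda>y. y powr q) has_real_derivative q * x powr (q - 1)) (at x)"
proof (cases "x = 0")
  case False
  then show ?thesis using has_real_derivative_powr[of x q] assms by simp
next
  case True
  have "((\<lambda>y::real. \<bar>y\<bar> powr (q - 1)) \<longlongrightarrow> \<bar>0\<bar> powr (q - 1)) (at 0)"
    by (intro tendsto_intros) (use assms in auto)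
  then have "((\<lambda>y::real. \<bar>y\<bar> powr (q - 1)) \<longlongrightarrow> 0) (at 0)" by simp
  then have "((\<lambda>y::real. \<bar>y powr q / y\<bar>) \<longlongrightarrow> 0) (at 0)"
  proof (rule Lim_transform_eventually)
    have "\<bar>y\<bar> powr (q - 1) = \<bar>y powr q / y\<bar>" if "y \<noteq> 0" for y :: real
    proof -
      have "\<bar>y\<bar> powr q = y powr q" by (cases "y \<ge> 0") (auto simp: uminus_powr_eq)
      then show ?thesis using that by (simp add: powr_diff abs_divide)
    qed
    then show "\<forall>\<^sub>F y::real in at 0. \<bar>y\<bar> powr (q - 1) = \<bar>y powr q / y\<bar>"
      by (auto simp: eventually_at_filter)
  qed
  then have "((\<lambda>y::real. y powr q / y) \<longlongrightarrow> 0) (at 0)"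
    by (rule tendsto_rabs_zero_cancel)
  then show ?thesis using True by (simp add: has_field_derivative_iff)
qed

section \<open>The radial equation with a given right-hand side\<close>

text \<open>
  The coefficient \<open>r\<^sup>n exp(H)\<close>, with \<open>n = N - 1\<close>, that turns the equation into divergence form.
\<close>
definition weight :: "nat \<Rightarrow> (real \<Rightarrow> real) \<Rightarrow> real \<Rightarrow> real" where
  "weight n h r = r ^ n * exp (integral {0..r} h)"

definition flux :: "nat \<Rightarrow> (real \<Rightarrow> real) \<Rightarrow> (real \<Rightarrow> real) \<Rightarrow> real \<Rightarrow> real" where
  "flux n h g r = integral {0..r} (\<lambda>s. weight n h s * g s)"

text \<open>
  The derivative of the solution with right-hand side \<open>g\<close>.  At \<open>r = 0\<close> the quotient is \<open>0 / 0 = 0\<close>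
  for \<open>n \<ge> 1\<close>, and \<open>0 powr b = 0\<close>, so that the value there is the right one, \<open>u'(0) = 0\<close>.
\<close>
definition slope :: "nat \<Rightarrow> real \<Rightarrow> (real \<Rightarrow> real) \<Rightarrow> (real \<Rightarrow> real) \<Rightarrow> real \<Rightarrow> real" where
  "slope n p h g r = (flux n h g r / weight n h r) powr (1 / (p - 1))"

lemma flux_0 [simp]: "flux n h g 0 = 0"
  by (simp add: flux_def)

lemma slope_0 [simp]: "slope n p h g 0 = 0"
  by (simp add: slope_def)

locale radial_operator =
  fixes n :: nat and p :: real and h :: "real \<Rightarrow> real"
  assumes n_pos: "n \<ge> 1" and p_gt_1: "p > 1"
    and cont_h: "continuous_on {0..} h" and h_nonneg: "\<And>r. r \<ge> 0 \<Longrightarrow> h r \<ge> 0"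
begin

lemma integral_h_deriv:
  "r \<ge> 0 \<Longrightarrow> ((\<lambda>x. integral {0..x} h) has_real_derivative h r) (at r within {0..})"
  by (rule has_real_derivative_integral_atLeast[OF cont_h])

lemma integral_h_cont: "continuous_on {0..} (\<lambda>x. integral {0..x} h)"
  by (rule DERIV_continuous_on[where D=h]) (auto intro: integral_h_deriv)

lemma integral_h_mono: "0 \<le> s \<Longrightarrow> s \<le> r \<Longrightarrow> integral {0..s} h \<le> integral {0..r} h"
  by (rule integral_subset_le)
     (auto intro!: integrable_continuous_real[OF continuous_on_subset[OF cont_h]] h_nonneg)

lemma integral_h_nonneg: "0 \<le> r \<Longrightarrow> integral {0..r} h \<ge> 0"
  using integral_h_mono[of 0 r] by simp

lemma weight_cont: "continuous_on {0..} (weight n h)"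
  unfolding weight_def by (intro continuous_intros integral_h_cont)

lemma weight_pos: "r > 0 \<Longrightarrow> weight n h r > 0"
  by (simp add: weight_def)

lemma weight_nonneg: "r \<ge> 0 \<Longrightarrow> weight n h r \<ge> 0"
  by (simp add: weight_def)

lemma weight_mono: "0 \<le> s \<Longrightarrow> s \<le> r \<Longrightarrow> weight n h s \<le> weight n h r"
  unfolding weight_def by (intro mult_mono power_mono) (auto intro: integral_h_mono)

lemma slope_nonneg: "slope n p h g r \<ge> 0"
  by (simp add: slope_def)

lemma flux_deriv:
  assumes "continuous_on {0..} g" and "r \<ge> 0"
  shows "(flux n h g has_real_derivative weight n h r * g r) (at r within {0..})"
  unfolding flux_def
  by (rule has_real_derivative_integral_atLeast) (use assms weight_cont in \<open>auto intro: continuous_intros\<close>)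

lemma flux_cont: "continuous_on {0..} g \<Longrightarrow> continuous_on {0..} (flux n h g)"
  by (rule DERIV_continuous_on) (auto intro: flux_deriv)

lemma weighted_integrable:
  assumes "continuous_on {0..} g"
  shows "(\<lambda>s. weight n h s * g s) integrable_on {0..r}"
  by (rule integrable_continuous_real)
     (auto intro!: continuous_intros continuous_on_subset[OF assms] continuous_on_subset[OF weight_cont])

lemma flux_nonneg:
  assumes "\<And>s. s \<ge> 0 \<Longrightarrow> g s \<ge> 0" 
  shows "flux n h g r \<ge> 0"
proof (cases "(\<lambda>s. weight n h s * g s) integrable_on {0..r}")
  case True
  then show ?thesis unfolding flux_def using assms weight_nonneg
    by (intro integral_nonneg) auto
next
  case False
  then show ?thesis by (simp add: flux_def not_integrable_integral)
qed

lemma flux_le_weight: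
  assumes "continuous_on {0..} g" "r \<ge> 0" "\<And>s. 0 \<le> s \<Longrightarrow> s \<le> r \<Longrightarrow> 0 \<le> g s \<and> g s \<le> M"
  shows "flux n h g r \<le> weight n h r * M * r"
proof -
  have "flux n h g r \<le> integral {0..r} (\<lambda>s. weight n h r * M)"
    unfolding flux_def
    by (rule integral_le[OF weighted_integrable]) 
       (use assms in \<open>auto intro!: mult_mono weight_mono weight_nonneg\<close>)
  then show ?thesis using assms by (simp add: mult_ac)
qed

lemma flux_mono:
  assumes "continuous_on {0..} g" "continuous_on {0..} g'"
    and "\<And>s. 0 \<le> s \<Longrightarrow> s \<le> r \<Longrightarrow> g s \<le> g' s"
  shows "flux n h g r \<le> flux n h g' r"
  unfolding flux_def
  by (intro integral_le weighted_integrable assms mult_left_mono) (auto intro: assms weight_nonneg)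

lemma slope_mono:
  assumes "continuous_on {0..} g" "continuous_on {0..} g'" "r \<ge> 0"
    and "\<And>s. 0 \<le> s \<Longrightarrow> 0 \<le> g s" and "\<And>s. 0 \<le> s \<Longrightarrow> s \<le> r \<Longrightarrow> g s \<le> g' s"
  shows "slope n p h g r \<le> slope n p h g' r"
  unfolding slope_def
  by (intro powr_mono2 divide_right_mono flux_mono assms) 
     (use p_gt_1 assms flux_nonneg[of g r] weight_nonneg in auto)

lemma slope_cmult:
  assumes "c \<ge> 0" shows "slope n p h (\<lambda>s. c * g s) r = c powr (1 / (p - 1)) * slope n p h g r"
proof -
  have "flux n h (\<lambda>s. c * g s) r = c * flux n h g r"
    unfolding flux_def by (simp add: mult.left_commute)
  then show ?thesis by (simp add: slope_def powr_mult powr_divide)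
qed

text \<open>
  Only the origin needs an argument: if \<open>g \<le> M\<close> near \<open>0\<close>, monotonicity of the weight gives
  \<open>flux / weight \<le> M r\<close>.
\<close>
lemma slope_cont:
  assumes g: "continuous_on {0..} g" and gn: "\<And>s. s \<ge> 0 \<Longrightarrow> g s \<ge> 0"
  shows "continuous_on {0..} (slope n p h g)"
proof -
  have "continuous_on {0..} (\<lambda>r. flux n h g r / weight n h r)"
    unfolding continuous_on_eq_continuous_within
  proof
    fix r :: real assume "r \<in> {0..}"
    then consider "r = 0" | "r > 0" by fastforce
    then show "continuous (at r within {0..}) (\<lambda>r. flux n h g r / weight n h r)"
    proof cases
      case 2
      have "continuous (at r within {0..}) (flux n h g)" "continuous (at r within {0..}) (weight n h)"
        using 2 flux_cont[OF g] weight_cont by (auto simp: continuous_on_eq_continuous_within)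
      then show ?thesis using weight_pos[OF 2] by (intro continuous_intros) auto
    next
      case 1
      have "compact (g ` {0..1})"
        by (intro compact_continuous_image continuous_on_subset[OF g]) auto
      then obtain M where M: "\<And>s. 0 \<le> s \<Longrightarrow> s \<le> 1 \<Longrightarrow> g s \<le> M"
        using bounded_imp_bdd_above[OF compact_imp_bounded] by (fastforce simp: bdd_above_def)
      have "((\<lambda>r. flux n h g r / weight n h r) \<longlongrightarrow> 0) (at 0 within {0..})"
      proof (rule tendsto_sandwich)
        show "\<forall>\<^sub>F r in at 0 within {0..}. 0 \<le> flux n h g r / weight n h r"
          by (auto simp: eventually_at_filter intro!: always_eventually divide_nonneg_nonneg flux_nonneg gn weight_nonneg)
        have "flux n h g r / weight n h r \<le> M * r" if "0 < r" "r < 1" for r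
          using flux_le_weight[OF g, of r M] that M gn weight_pos[of r]
          by (simp add: divide_le_eq mult_ac)
        then show "\<forall>\<^sub>F r in at 0 within {0..}. flux n h g r / weight n h r \<le> M * r"
          unfolding eventually_at by (intro exI[of _ 1]) (auto simp: dist_real_def)
        have "((\<lambda>r. M * r) \<longlongrightarrow> M * 0) (at 0 within {0..})" by (intro tendsto_intros)
        then show "((\<lambda>r. M * r) \<longlongrightarrow> 0) (at 0 within {0..})" by simp
      qed auto
      then show ?thesis using 1 by (simp add: continuous_within)
    qed
  qed
  then show ?thesis
    unfolding slope_def
    by (rule continuous_on_powr'[OF _ continuous_on_const])
       (use p_gt_1 flux_nonneg[of g] gn weight_nonneg in auto)
qed

lemma weight_powr_slope:
  assumes "r > 0" and "\<And>s. s \<ge> 0 \<Longrightarrow> g s \<ge> 0"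
  shows "weight n h r * slope n p h g r powr (p - 1) = flux n h g r"
proof -
  have "slope n p h g r powr (p - 1) = flux n h g r / weight n h r"
    unfolding slope_def powr_powr using p_gt_1 flux_nonneg[of g r] weight_pos[OF assms(1)] assms
    by simp
  then show ?thesis using weight_pos[OF assms(1)] by simp
qed

text \<open>
  The quantity \<open>r\<^sup>n |u'|\<^sup>p\<^sup>-\<^sup>2 u'\<close> of the equation is \<open>exp(-H)\<close> times the flux; differentiating this product
  produces the gradient term.
\<close>
lemma positive_radial_solution_of_slope:
  assumes g: "continuous_on {0..} g" and gn: "\<And>s. s \<ge> 0 \<Longrightarrow> g s \<ge> 0"
    and pos: "\<And>r. r \<ge> 0 \<Longrightarrow> u r > 0"
    and u: "\<And>r. r \<ge> 0 \<Longrightarrow> (u has_real_derivative slope n p h g r) (at r within {0..})"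
  shows "positive_radial_solution (Suc n) p h g u"
proof -
  let ?v = "slope n p h g"
  let ?q = "\<lambda>r. r ^ n * g r - r ^ n * h r * \<bar>?v r\<bar> powr (p - 1)"
  have pw: "r ^ n * \<bar>?v r\<bar> powr (p - 2) * ?v r = exp (- integral {0..r} h) * flux n h g r"
    if "r > 0" for r
  proof -
    have "\<bar>?v r\<bar> powr (p - 2) * ?v r = ?v r powr (p - 1)"
      using powr_mult_base[OF slope_nonneg, of g r "p - 2"] slope_nonneg[of g r]
      by (simp add: mult.commute)
    then show ?thesis using weight_powr_slope[OF that gn]
      by (simp add: weight_def exp_minus field_simps flip: mult.assoc)
  qed
  have "((\<lambda>s. s ^ n * \<bar>?v s\<bar> powr (p - 2) * ?v s) has_real_derivative ?q r) (at r)" if r: "r > 0" for r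
  proof -
    have "((\<lambda>s. exp (- integral {0..s} h) * flux n h g s) has_real_derivative
        exp (- integral {0..r} h) * (- h r) * flux n h g r 
          + exp (- integral {0..r} h) * (weight n h r * g r)) (at r within {0..})"
      by (rule derivative_eq_intros integral_h_deriv flux_deriv[OF g] refl | use r in simp)+
    also have "exp (- integral {0..r} h) * (- h r) * flux n h g r 
          + exp (- integral {0..r} h) * (weight n h r * g r) = ?q r"
      using weight_powr_slope[OF r gn] slope_nonneg[of g r]
      by (simp add: weight_def exp_minus field_simps)
    finally have "((\<lambda>s. exp (- integral {0..s} h) * flux n h g s) has_real_derivative ?q r) (at r)"
      by (rule has_real_derivative_within_atLeast_at) (fact r)
    then show ?thesis
      by (rule DERIV_cong_ev[THEN iffD1, rotated -1, OF _ refl _ refl])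
         (use r pw in \<open>auto simp: eventually_nhds intro!: exI[of _ "{0<..}"]\<close>)
  qed
  moreover have "continuous_on {0<..} ?q"
    using p_gt_1 slope_nonneg
    by (intro continuous_intros continuous_on_powr' continuous_on_subset[OF slope_cont[OF g gn]]
        continuous_on_subset[OF g] continuous_on_subset[OF cont_h]) auto
  ultimately show ?thesis
    unfolding positive_radial_solution_def using pos u slope_cont[OF g gn]
    by (intro conjI allI impI exI[of _ ?v] exI[of _ ?q]) auto
qed

text \<open>
  Here the sign of \<open>u'\<close> is not given in advance.  Put \<open>w = r\<^sup>n |u'|\<^sup>p\<^sup>-\<^sup>2 u'\<close>; the equation reads
  \<open>w' = r\<^sup>n g - h |w|\<close>.  Where \<open>w < 0\<close> this makes \<open>exp(-H) w\<close> nondecreasing, so \<open>w\<close>, which vanishes at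
  \<open>0\<close>, never becomes negative.  For \<open>w \<ge> 0\<close> it says \<open>(exp(H) w)' = (weight) g\<close>, and \<open>exp(H) w\<close> is the flux.
\<close>
lemma slope_of_positive_radial_solution:
  assumes g: "continuous_on {0..} g" and gn: "\<And>s. s \<ge> 0 \<Longrightarrow> g s \<ge> 0"
    and sol: "positive_radial_solution (Suc n) p h g u" and r: "r \<ge> 0"
  shows "(u has_real_derivative slope n p h g r) (at r within {0..})"
proof -
  obtain v q where u: "\<And>r. r \<ge> 0 \<Longrightarrow> (u has_real_derivative v r) (at r within {0..})"
    and v: "continuous_on {0..} v" and v0: "v 0 = 0"
    and q: "\<And>r. r > 0 \<Longrightarrow> ((\<lambda>s. s ^ n * \<bar>v s\<bar> powr (p - 2) * v s) has_real_derivative q r) (at r)"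
    and eq: "\<And>r. r > 0 \<Longrightarrow> q r + r ^ n * h r * \<bar>v r\<bar> powr (p - 1) = r ^ n * g r"
    using sol unfolding positive_radial_solution_def by auto
  define w where "w = (\<lambda>s. s ^ n * \<bar>v s\<bar> powr (p - 2) * v s)"
  have absw: "\<bar>w s\<bar> = s ^ n * \<bar>v s\<bar> powr (p - 1)" if "s \<ge> 0" for s
    using that powr_mult_base[of "\<bar>v s\<bar>" "p - 2"] by (simp add: w_def abs_mult mult_ac)
  have w_deriv: "(w has_real_derivative s ^ n * g s - h s * \<bar>w s\<bar>) (at s)" if "s > 0" for s
    using q[OF that] eq[OF that] absw[of s] that unfolding w_def[symmetric]
    by (simp add: algebra_simps) (metis add_diff_cancel_right' mult.left_commute)
  have w0: "w 0 = 0" using v0 by (simp add: w_def)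
  have w_cont: "continuous_on {0..} w"
    unfolding continuous_on_eq_continuous_within
  proof
    fix s :: real assume "s \<in> {0..}"
    then consider "s = 0" | "s > 0" by fastforce
    then show "continuous (at s within {0..}) w"
    proof cases
      case 2
      then show ?thesis using DERIV_isCont[OF w_deriv[OF 2]] continuous_at_imp_continuous_at_within by blast
    next
      case 1
      have "continuous_on {0..} (\<lambda>s. s ^ n * \<bar>v s\<bar> powr (p - 1))"
        using p_gt_1 by (intro continuous_intros continuous_on_powr' v) auto
      then have "((\<lambda>s. s ^ n * \<bar>v s\<bar> powr (p - 1)) \<longlongrightarrow> 0) (at 0 within {0..})"
        using v0 by (force simp: continuous_on_def dest!: bspec[of _ _ 0])
      then have "((\<lambda>s. \<bar>w s\<bar>) \<longlongrightarrow> 0) (at 0 within {0..})"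
        by (rule Lim_transform_eventually) (auto simp: eventually_at_filter absw)
      then have "(w \<longlongrightarrow> 0) (at 0 within {0..})" by (rule tendsto_rabs_zero_cancel)
      then show ?thesis using 1 w0 by (simp add: continuous_within)
    qed
  qed
  have H_deriv: "((\<lambda>x. integral {0..x} h) has_real_derivative h s) (at s)" if "s > 0" for s
    using integral_h_deriv[of s] that by (intro has_real_derivative_within_atLeast_at[of _ _ s 0]) auto
  have w_nonneg: "w b \<ge> 0" if "b \<ge> 0" for b
  proof (rule ccontr)
    assume neg: "\<not> w b \<ge> 0"
    \<comment> \<open>Let \<open>c\<close> be the last point before \<open>b\<close> where \<open>w \<ge> 0\<close>; then \<open>w < 0\<close> on \<open>(c, b]\<close>.\<close>
    define S where "S = {s \<in> {0..b}. w s \<ge> 0}"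
    have "compact S"
    proof -
      have "closed ({0..b} \<inter> w -` {0..})"
        by (intro continuous_closed_preimage continuous_on_subset[OF w_cont]) auto
      moreover have "{0..b} \<inter> w -` {0..} = S" by (auto simp: S_def)
      ultimately have "closed S" by simp
      then show ?thesis unfolding compact_eq_bounded_closed
        by (auto simp: S_def intro: bounded_subset[of "{0..b}"])
    qed
    moreover have "0 \<in> S" using w0 that by (simp add: S_def)
    ultimately obtain c where c: "c \<in> S" and cmax: "\<And>s. s \<in> S \<Longrightarrow> s \<le> c"
      using compact_attains_sup[of S] by blast
    have "c < b" using c neg by (cases "c = b") (auto simp: S_def)
    have "c \<ge> 0" using c by (simp add: S_def)
    have wneg: "w s < 0" if "c < s" "s \<le> b" for s
      using cmax[of s] that \<open>c \<ge> 0\<close> by (force simp: S_def)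
    have "exp (- integral {0..c} h) * w c \<le> exp (- integral {0..b} h) * w b"
    proof (rule DERIV_nonneg_imp_increasing_open[where f="\<lambda>s. exp (- integral {0..s} h) * w s"])
      show "continuous_on {c..b} (\<lambda>s. exp (- integral {0..s} h) * w s)"
        using \<open>c \<ge> 0\<close> by (intro continuous_intros continuous_on_subset[OF w_cont]
            continuous_on_subset[OF integral_h_cont]) auto
      fix s assume s: "c < s" "s < b"
      then have "s > 0" using \<open>c \<ge> 0\<close> by simp
      have "((\<lambda>s. exp (- integral {0..s} h) * w s) has_real_derivative
          exp (- integral {0..s} h) * (- h s) * w s 
          + exp (- integral {0..s} h) * (s ^ n * g s - h s * \<bar>w s\<bar>)) (at s)"
        by (rule derivative_eq_intros H_deriv w_deriv refl | use \<open>s > 0\<close> in simp)+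
      moreover have "exp (- integral {0..s} h) * (- h s) * w s 
          + exp (- integral {0..s} h) * (s ^ n * g s - h s * \<bar>w s\<bar>)
          = exp (- integral {0..s} h) * (s ^ n * g s)"
        using wneg[of s] s by (simp add: algebra_simps)
      moreover have "exp (- integral {0..s} h) * (s ^ n * g s) \<ge> 0"
        using gn[of s] \<open>s > 0\<close> by simp
      ultimately show "\<exists>y. ((\<lambda>s. exp (- integral {0..s} h) * w s) has_real_derivative y) (at s) \<and> 0 \<le> y"
        by auto
    qed (use \<open>c < b\<close> in simp)
    moreover have "exp (- integral {0..c} h) * w c \<ge> 0" using c by (simp add: S_def)
    moreover have "exp (- integral {0..b} h) * w b < 0" using neg by (simp add: mult_pos_neg)
    ultimately show False by simp
  qed
  have flux: "exp (integral {0..b} h) * w b = flux n h g b" if "b > 0" for b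
  proof -
    let ?D = "\<lambda>s. exp (integral {0..s} h) * w s - flux n h g s"
    have "?D b = ?D 0"
    proof (rule DERIV_isconst_end[where f="?D", OF that])
      show "continuous_on {0..b} ?D"
        by (intro continuous_intros continuous_on_subset[OF w_cont] continuous_on_subset[OF flux_cont[OF g]]
            continuous_on_subset[OF integral_h_cont]) auto
      fix s assume s: "0 < s" "s < b"
      have fd: "(flux n h g has_real_derivative weight n h s * g s) (at s)"
        using s by (intro has_real_derivative_within_atLeast_at[OF flux_deriv[OF g]]) auto
      have "(?D has_real_derivative exp (integral {0..s} h) * h s * w s 
          + exp (integral {0..s} h) * (s ^ n * g s - h s * \<bar>w s\<bar>) - weight n h s * g s) (at s)"
        by (rule derivative_eq_intros H_deriv w_deriv fd refl | use s in simp)+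
      moreover have "exp (integral {0..s} h) * h s * w s 
          + exp (integral {0..s} h) * (s ^ n * g s - h s * \<bar>w s\<bar>) - weight n h s * g s = 0"
        using w_nonneg[of s] s by (simp add: algebra_simps weight_def)
      ultimately show "(?D has_real_derivative 0) (at s)" by simp
    qed
    then show ?thesis using w0 by simp
  qed
  have "v r = slope n p h g r"
  proof (cases "r = 0")
    case True then show ?thesis using v0 by simp
  next
    case False
    then have "r > 0" using r by simp
    have "v r \<ge> 0"
    proof (rule ccontr)
      assume "\<not> v r \<ge> 0"
      then have "w r < 0" using \<open>r > 0\<close> by (auto simp: w_def intro!: mult_pos_neg)
      then show False using w_nonneg[of r] r by simp
    qed
    have "w r = r ^ n * v r powr (p - 1)" using absw[OF r] w_nonneg[OF r] \<open>v r \<ge> 0\<close> by simp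
    then have "flux n h g r / weight n h r = v r powr (p - 1)"
      using flux[OF \<open>r > 0\<close>] \<open>r > 0\<close> by (simp add: weight_def flip: flux[OF \<open>r > 0\<close>])
    then show ?thesis using \<open>v r \<ge> 0\<close> p_gt_1 by (simp add: slope_def powr_powr)
  qed
  then show ?thesis using u[OF r] by simp
qed

end

section \<open>Separation of variables and the energy inequality\<close>

text \<open>
  The derivative of the integral of \<open>\<psi>\<close> up to \<open>U(s)\<close> is \<open>\<psi>(U) U' \<le> m\<close>.  The values of \<open>U\<close> lie strictly
  above the base point \<open>b\<close> so that the inner integral is differentiable from both sides.
\<close>
lemma separation_of_variables:
  fixes \<psi> U U' m :: "real \<Rightarrow> real"
  assumes "R \<le> r" and \<psi>: "continuous_on {b..} \<psi>"
    and U: "continuous_on {R..r} U" "\<And>s. R \<le> s \<Longrightarrow> s \<le> r \<Longrightarrow> U s > b"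
    and U': "\<And>s. R < s \<Longrightarrow> s < r \<Longrightarrow> (U has_real_derivative U' s) (at s)"
    and m: "continuous_on {R..r} m"
    and le: "\<And>s. R < s \<Longrightarrow> s < r \<Longrightarrow> U' s * \<psi> (U s) \<le> m s"
  shows "integral {b..U r} \<psi> \<le> integral {b..U R} \<psi> + integral {R..r} m"
proof -
  let ?D = "\<lambda>s. integral {b..U s} \<psi> - integral {R..s} m"
  have \<Psi>: "((\<lambda>x. integral {b..x} \<psi>) has_real_derivative \<psi> x) (at x)" if "x > b" for x
    by (rule has_real_derivative_within_atLeast_at[OF has_real_derivative_integral_atLeast[OF \<psi>]])
       (use that in auto)
  have "?D r \<le> ?D R"
  proof (rule DERIV_nonpos_imp_decreasing_open[where f="?D", OF \<open>R \<le> r\<close>])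
    fix s assume s: "R < s" "s < r"
    have "((\<lambda>x. integral {R..x} m) has_real_derivative m s) (at s within {R..r})"
      by (rule integral_has_real_derivative[OF m]) (use s in auto)
    then have "((\<lambda>x. integral {R..x} m) has_real_derivative m s) (at s)"
      using s by (simp add: at_within_Icc_at)
    moreover have "((\<lambda>s. integral {b..U s} \<psi>) has_real_derivative \<psi> (U s) * U' s) (at s)"
      by (rule DERIV_chain2[OF \<Psi> U']) (use s U in auto)
    ultimately have "(?D has_real_derivative \<psi> (U s) * U' s - m s) (at s)"
      by (intro DERIV_diff)
    then show "\<exists>y. (?D has_real_derivative y) (at s) \<and> y \<le> 0"
      using le[OF s] by (intro exI[of _ "\<psi> (U s) * U' s - m s"]) (auto simp: mult.commute)
  next
    have "continuous_on {b<..} (\<lambda>x. integral {b..x} \<psi>)"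
      by (intro continuous_at_imp_continuous_on ballI DERIV_isCont[OF \<Psi>]) auto
    then have "continuous_on {R..r} (\<lambda>s. integral {b..U s} \<psi>)"
      by (rule continuous_on_compose2[OF _ U(1)]) (use U in auto)
    moreover have "continuous_on {R..r} (\<lambda>s. integral {R..s} m)"
      by (intro indefinite_integral_continuous_1 integrable_continuous_real m)
    ultimately show "continuous_on {R..r} ?D" by (intro continuous_intros)
  qed
  then show ?thesis by simp
qed

lemma bounded_of_divergent_integral:
  fixes \<psi> :: "real \<Rightarrow> real"
  assumes \<psi>: "continuous_on {0<..} \<psi>" "\<And>x. x > 0 \<Longrightarrow> \<psi> x \<ge> 0"
    and div: "\<exists>c>0. filterlim (\<lambda>r. integral {c..r} \<psi>) at_top at_top" and "b > 0"
  obtains B where "\<And>x. integral {b..x} \<psi> \<le> K \<Longrightarrow> x \<le> B"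
proof -
  obtain c where "c > 0" and c: "filterlim (\<lambda>r. integral {c..r} \<psi>) at_top at_top" using div by blast
  have int: "\<psi> integrable_on {x..y}" if "x > 0" for x y
    by (intro integrable_continuous_real continuous_on_subset[OF \<psi>(1)]) (use that in auto)
  let ?d = "max b c"
  obtain B0 where B0: "\<And>x. x \<ge> B0 \<Longrightarrow> integral {c..x} \<psi> > K + integral {c..?d} \<psi>"
    using c unfolding filterlim_at_top_dense eventually_at_top_linorder by blast
  have "x \<le> max ?d B0" if "integral {b..x} \<psi> \<le> K" for x
  proof (rule ccontr)
    assume "\<not> x \<le> max ?d B0"
    then have x: "x > ?d" "x \<ge> B0" by auto
    have "integral {?d..x} \<psi> \<le> integral {b..x} \<psi>"
      by (intro integral_subset_le int) (use \<open>b > 0\<close> \<psi>(2) in auto)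
    moreover have "integral {c..?d} \<psi> + integral {?d..x} \<psi> = integral {c..x} \<psi>"
      by (rule Henstock_Kurzweil_Integration.integral_combine) (use x int[OF \<open>c > 0\<close>] in auto)
    ultimately show False using B0[OF x(2)] that by simp
  qed
  then show ?thesis by (rule that)
qed

context radial_operator
begin

lemma slope_powr: "slope n p h g r powr p = flux n h g r powr (p / (p - 1)) / weight n h r powr (p / (p - 1))"
  by (simp add: slope_def powr_powr powr_divide)

text \<open>
  The function \<open>W\<^sup>q - q \<Gamma> F(U)\<close>, with \<open>q = p/(p-1)\<close> and \<open>\<Gamma>\<close> fixed, is nonincreasing on \<open>[R, r]\<close>.  Indeed
  \<open>W\<^bsup>q-1\<^esup> = P\<^bsup>q-1\<^esup> slope\<close>, because \<open>q - 1 = 1/(p-1)\<close>, so that \<open>(W\<^sup>q)' = q P\<^sup>q a \<phi> slope\<close>, and here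
  \<open>P\<^sup>q a \<le> \<Gamma>\<close> while \<open>\<phi> slope \<le> G(U) U' = (F(U))'\<close>.  In the applications \<open>\<phi> = f\<^sub>j(u\<^sub>1, u\<^sub>2)\<close>; the function
  \<open>U\<close> is not tied to the pair inside \<open>\<phi>\<close>, since in the Picard iteration it belongs to the next iterate.
\<close>
lemma energy_estimate:
  fixes a \<phi> U U' F G :: "real \<Rightarrow> real"
  assumes cont: "continuous_on {0..} (\<lambda>s. a s * \<phi> s)"
    and a: "\<And>s. s \<ge> 0 \<Longrightarrow> a s \<ge> 0" and \<phi>: "\<And>s. s \<ge> 0 \<Longrightarrow> \<phi> s \<ge> 0"
    and R: "0 \<le> R" "R \<le> r"
    and \<Gamma>: "\<Gamma> \<ge> 0" "\<And>s. R < s \<Longrightarrow> s < r \<Longrightarrow> weight n h s powr (p / (p - 1)) * a s \<le> \<Gamma>"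
    and F: "\<And>x. x > 0 \<Longrightarrow> (F has_real_derivative G x) (at x)" "\<And>x. x > 0 \<Longrightarrow> F x \<ge> 0"
    and U: "continuous_on {R..r} U" "\<And>s. R \<le> s \<Longrightarrow> s \<le> r \<Longrightarrow> U s > 0"
    and U': "\<And>s. R < s \<Longrightarrow> s < r \<Longrightarrow> (U has_real_derivative U' s) (at s)"
    and \<phi>_le: "\<And>s. R < s \<Longrightarrow> s < r \<Longrightarrow> \<phi> s \<le> G (U s)"
    and slope_le: "\<And>s. R < s \<Longrightarrow> s < r \<Longrightarrow> slope n p h (\<lambda>s. a s * \<phi> s) s \<le> U' s"
  shows "flux n h (\<lambda>s. a s * \<phi> s) r powr (p / (p - 1)) \<le>
    flux n h (\<lambda>s. a s * \<phi> s) R powr (p / (p - 1)) + p / (p - 1) * \<Gamma> * F (U r)"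
proof -
  let ?g = "\<lambda>s. a s * \<phi> s"
  define q where "q = p / (p - 1)"
  have q: "q > 1" using p_gt_1 by (simp add: q_def field_simps)
  have q1: "q - 1 = 1 / (p - 1)" using p_gt_1 by (simp add: q_def field_simps)
  have gn: "?g s \<ge> 0" if "s \<ge> 0" for s using a \<phi> that by simp
  let ?D = "\<lambda>s. flux n h ?g s powr q - q * \<Gamma> * F (U s)"
  have "?D r \<le> ?D R"
  proof (rule DERIV_nonpos_imp_decreasing_open[where f="?D", OF R(2)])
    fix s assume s: "R < s" "s < r"
    then have s0: "s > 0" using R by simp
    let ?W = "flux n h ?g s" and ?P = "weight n h s" and ?S = "slope n p h ?g s"
    have "(flux n h ?g has_real_derivative ?P * ?g s) (at s)"
      using s0 by (intro has_real_derivative_within_atLeast_at[OF flux_deriv[OF cont]]) auto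
    then have "((\<lambda>s. flux n h ?g s powr q) has_real_derivative q * ?W powr (q - 1) * (?P * ?g s)) (at s)"
      by (intro DERIV_chain2[OF has_real_derivative_powr_at_nonneg] flux_nonneg gn q)
    moreover have "((\<lambda>s. F (U s)) has_real_derivative G (U s) * U' s) (at s)"
      by (intro DERIV_chain2[OF F(1) U']) (use s U in auto)
    ultimately have D: "(?D has_real_derivative q * ?W powr (q - 1) * (?P * ?g s) - q * \<Gamma> * (G (U s) * U' s)) (at s)"
      by (intro DERIV_diff DERIV_cmult)
    have "?W powr (q - 1) = ?P powr (q - 1) * ?S"
      using weight_pos[OF s0] by (simp add: q1 slope_def powr_divide)
    moreover have "?P powr (q - 1) * ?P = ?P powr q"
      using powr_mult_base[of ?P "q - 1"] weight_pos[OF s0] by (simp add: mult.commute)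
    ultimately have "?W powr (q - 1) * (?P * ?g s) = (?P powr q * a s) * (\<phi> s * ?S)"
      by (simp flip: \<open>_ = ?P powr q\<close>)
    also have "\<dots> \<le> \<Gamma> * (G (U s) * U' s)"
      using \<Gamma>(1) \<Gamma>(2)[OF s] \<phi>[of s] \<phi>_le[OF s] slope_le[OF s] slope_nonneg[of ?g s] a[of s] s0
      by (intro mult_mono mult_nonneg_nonneg) (auto simp: q_def)
    finally have "q * (?W powr (q - 1) * (?P * ?g s)) \<le> q * (\<Gamma> * (G (U s) * U' s))"
      using q by (intro mult_left_mono) auto
    then show "\<exists>y. (?D has_real_derivative y) (at s) \<and> y \<le> 0"
      using D by (intro exI conjI) (auto simp: mult.assoc)
  next
    have "continuous_on {0<..} F"
      by (intro continuous_at_imp_continuous_on ballI DERIV_isCont[OF F(1)]) auto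
    then have "continuous_on {R..r} (\<lambda>s. F (U s))"
      by (rule continuous_on_compose2[OF _ U(1)]) (use U in auto)
    moreover have "continuous_on {R..r} (\<lambda>s. flux n h ?g s powr q)"
      by (rule continuous_on_powr'[OF _ continuous_on_const])
         (use continuous_on_subset[OF flux_cont[OF cont], of "{R..r}"] R q flux_nonneg[of ?g] gn in auto)
    ultimately show "continuous_on {R..r} ?D" by (intro continuous_on_diff continuous_on_mult_left)
  qed
  moreover have "q * \<Gamma> * F (U R) \<ge> 0" using q \<Gamma>(1) F(2) U(2) R by simp
  ultimately show ?thesis by (simp add: q_def)
qed

end

section \<open>Improper integrals of continuous functions\<close>

text \<open>
  If the integrals over \<open>[c, r]\<close> stayed bounded, they would converge, and then the integral over
  \<open>[c, \<infinity>)\<close> would be finite.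
\<close>

lemma integral_at_top_of_nn_integral_infinite:
  fixes g :: "real \<Rightarrow> real"
  assumes g: "continuous_on {c..} g" "\<And>t. t \<ge> c \<Longrightarrow> g t \<ge> 0"
    and inf: "(\<integral>\<^sup>+t\<in>{c..}. ennreal (g t) \<partial>lborel) = \<infinity>"
  shows "filterlim (\<lambda>r. integral {c..r} g) at_top at_top"
proof -
  let ?I = "\<lambda>r. integral {c..r} g"
  have int: "g integrable_on {c..y}" for y
    by (intro integrable_continuous_real continuous_on_subset[OF g(1)]) auto
  have mono: "?I x \<le> ?I y" if "x \<le> y" for x y
    using that g(2) by (intro integral_subset_le int) auto
  have unb: "\<exists>y. ?I y > K" for K
  proof (rule ccontr)
    assume "\<nexists>y. ?I y > K"
    then have K: "?I y \<le> K" for y by (meson not_le)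
    then have bdd: "bdd_above (range ?I)" by (auto simp: bdd_above_def)
    have "(?I \<longlongrightarrow> Sup (range ?I)) at_top"
    proof (rule increasing_tendsto)
      show "\<forall>\<^sub>F y in at_top. ?I y \<le> Sup (range ?I)"
        by (intro always_eventually allI cSup_upper bdd) auto
      fix x assume "x < Sup (range ?I)"
      then obtain y where "x < ?I y" using less_cSup_iff[OF _ bdd] by auto
      then show "\<forall>\<^sub>F y in at_top. x < ?I y"
        unfolding eventually_at_top_linorder using mono by (meson less_le_trans)
    qed
    then have "(g has_integral Sup (range ?I)) {c..}"
      by (intro has_integral_to_inf int g(2))
    then have "(\<integral>\<^sup>+t\<in>{c..}. ennreal (g t) \<partial>lborel) = ennreal (Sup (range ?I))"
      by (intro nn_integral_has_integral_lebesgue') (use g(2) in auto)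
    then show False using inf by simp
  qed
  show ?thesis
    unfolding filterlim_at_top_dense eventually_at_top_linorder
    using unb mono by (meson less_le_trans)
qed

lemma integral_le_of_nn_integral_finite:
  fixes g :: "real \<Rightarrow> real"
  assumes g: "continuous_on {c..} g" "\<And>t. t \<ge> c \<Longrightarrow> g t \<ge> 0"
    and fin: "(\<integral>\<^sup>+t\<in>{c..}. ennreal (g t) \<partial>lborel) < \<infinity>"
  obtains K where "\<And>x y. c \<le> x \<Longrightarrow> integral {x..y} g \<le> K"
proof -
  obtain K where K: "(\<integral>\<^sup>+t\<in>{c..}. ennreal (g t) \<partial>lborel) = ennreal K" "K \<ge> 0"
    using fin by (cases "\<integral>\<^sup>+t\<in>{c..}. ennreal (g t) \<partial>lborel" rule: ennreal_cases) auto
  have "integral {x..y} g \<le> K" if "c \<le> x" for x y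
  proof -
    have "g integrable_on {x..y}"
      by (intro integrable_continuous_real continuous_on_subset[OF g(1)]) (use that in auto)
    then have "ennreal (integral {x..y} g) = (\<integral>\<^sup>+t\<in>{x..y}. ennreal (g t) \<partial>lborel)"
      by (intro nn_integral_has_integral_lebesgue'[symmetric] integrable_integral g(2)) (use that in auto)
    also have "\<dots> \<le> (\<integral>\<^sup>+t\<in>{c..}. ennreal (g t) \<partial>lborel)"
      by (intro nn_integral_mono) (use that in \<open>auto simp: indicator_def\<close>)
    finally show ?thesis using K by (simp add: ennreal_le_iff)
  qed
  then show ?thesis by (rule that)
qed

lemma powr_add_le:
  fixes x y c :: real
  assumes "x \<ge> 0" "y \<ge> 0" "c \<ge> 0"
  shows "(x + y) powr c \<le> (2 * x) powr c + (2 * y) powr c"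
proof (cases "x \<le> y")
  case True
  then have "(x + y) powr c \<le> (2 * y) powr c" using assms by (intro powr_mono2) auto
  then show ?thesis using powr_ge_zero[of "2 * x" c] by linarith
next
  case False
  then have "(x + y) powr c \<le> (2 * x) powr c" using assms by (intro powr_mono2) auto
  then show ?thesis using powr_ge_zero[of "2 * y" c] by linarith
qed

section \<open>The system\<close>

locale quasilinear_system =
  fixes N :: nat and p :: real
    and a h :: "nat \<Rightarrow> real \<Rightarrow> real"
    and f :: "nat \<Rightarrow> real \<times> real \<Rightarrow> real"
  assumes N: "N \<ge> 3" and p1: "1 < p" and pN: "p \<le> real N - 1"
    and a: "\<And>j. j \<in> {1, 2} \<Longrightarrow> continuous_on {0..} (a j) \<and> (\<forall>r\<ge>0. a j r \<ge> 0)"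
    and h: "\<And>j. j \<in> {1, 2} \<Longrightarrow> continuous_on {0..} (h j) \<and> (\<forall>r\<ge>0. h j r \<ge> 0)"
    and f: "\<And>j. j \<in> {1, 2} \<Longrightarrow>
           continuous_on ({0..} \<times> {0..}) (f j) \<and>
           (\<forall>s\<ge>0. \<forall>t\<ge>0. f j (s, t) \<ge> 0) \<and>
           (\<forall>t\<ge>0. mono_on {0..} (\<lambda>s. f j (s, t))) \<and>
           (\<forall>s\<ge>0. mono_on {0..} (\<lambda>t. f j (s, t))) \<and>
           (\<forall>s\<ge>0. \<forall>t\<ge>0. s > 0 \<or> t > 0 \<longrightarrow> f j (s, t) > 0)"
    and keller_osserman:
      "\<exists>c>0. filterlim (\<lambda>r. integral {c..r} (\<lambda>s. primitive_F f s powr (- 1 / p))) at_top at_top"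
begin

lemma operator: "j \<in> {1, 2} \<Longrightarrow> radial_operator (N - 1) p (h j)"
  using N p1 h by unfold_locales auto

lemma f_nonneg: "j \<in> {1, 2} \<Longrightarrow> s \<ge> 0 \<Longrightarrow> t \<ge> 0 \<Longrightarrow> f j (s, t) \<ge> 0"
  using f by auto

lemma f_pos: "j \<in> {1, 2} \<Longrightarrow> s > 0 \<Longrightarrow> t > 0 \<Longrightarrow> f j (s, t) > 0"
  using f by (meson less_imp_le)

lemma f_mono:
  assumes "j \<in> {1, 2}" "0 \<le> s" "s \<le> s'" "0 \<le> t" "t \<le> t'"
  shows "f j (s, t) \<le> f j (s', t')"
proof -
  have "f j (s, t) \<le> f j (s', t)"
    using f[OF assms(1)] assms by (intro mono_onD[of "{0..}" "\<lambda>s. f j (s, t)" s s']) auto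
  also have "\<dots> \<le> f j (s', t')"
    using f[OF assms(1)] assms by (intro mono_onD[of "{0..}" "\<lambda>t. f j (s', t)" t t']) auto
  finally show ?thesis .
qed

definition diag :: "real \<Rightarrow> real" where
  "diag t = f 1 (t, t) + f 2 (t, t)"

abbreviation F :: "real \<Rightarrow> real" where
  "F \<equiv> primitive_F f"

lemma f_le_diag: "j \<in> {1, 2} \<Longrightarrow> 0 \<le> s \<Longrightarrow> 0 \<le> t \<Longrightarrow> s \<le> x \<Longrightarrow> t \<le> x \<Longrightarrow> f j (s, t) \<le> diag x"
  using f_mono[of j s x t x] f_nonneg[of 1 x x] f_nonneg[of 2 x x] by (auto simp: diag_def)

lemma diag_cont: "continuous_on {0..} diag"
proof -
  have "continuous_on {0..} (\<lambda>t. f j (t, t))" if "j \<in> {1, 2}" for j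
    by (rule continuous_on_compose2[of "{0..} \<times> {0..}" "f j"])
       (use f[OF that] in \<open>auto intro!: continuous_intros\<close>)
  then show ?thesis unfolding diag_def by (intro continuous_intros) auto
qed

lemma F_eq: "F = (\<lambda>x. integral {0..x} diag)"
  unfolding primitive_F_def diag_def ..

lemma F_deriv: "x > 0 \<Longrightarrow> (F has_real_derivative diag x) (at x)"
  unfolding F_eq
  by (rule has_real_derivative_within_atLeast_at[OF has_real_derivative_integral_atLeast[OF diag_cont]]) auto

lemma diag_pos: "x > 0 \<Longrightarrow> diag x > 0"
  using f_pos[of 1 x x] f_pos[of 2 x x] by (simp add: diag_def)

lemma F_pos: assumes "x > 0" shows "F x > 0"
proof -
  have "F 0 < F x"
  proof (rule DERIV_pos_imp_increasing_open[OF assms])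
    show "continuous_on {0..x} F"
      unfolding F_eq
      by (intro indefinite_integral_continuous_1 integrable_continuous_real continuous_on_subset[OF diag_cont]) auto
  qed (use F_deriv diag_pos in blast)
  then show ?thesis by (simp add: primitive_F_def)
qed

lemma F_cont: "continuous_on {0<..} F"
  by (intro continuous_at_imp_continuous_on ballI DERIV_isCont[OF F_deriv]) auto

lemma F_mono: assumes "0 < x" "x \<le> y" shows "F x \<le> F y"
proof (rule DERIV_nonneg_imp_nondecreasing[OF assms(2)])
  fix z assume "x \<le> z" then show "\<exists>d. (F has_real_derivative d) (at z) \<and> 0 \<le> d"
    using F_deriv[of z] diag_pos[of z] assms by (intro exI[of _ "diag z"]) auto
qed

text \<open>
  The integrand of the Keller-Osserman condition.
\<close>
abbreviation \<psi> :: "real \<Rightarrow> real" where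
  "\<psi> x \<equiv> F x powr (- 1 / p)"

lemma \<psi>_cont: "continuous_on {0<..} \<psi>"
  by (intro continuous_intros F_cont) (use F_pos in fastforce)

lemma F_root_\<psi>: "x > 0 \<Longrightarrow> F x powr (1 / p) * \<psi> x = 1"
  using F_pos[of x] by (simp flip: powr_add)

lemma bounded_of_integral_\<psi>:
  assumes "b > 0" obtains B where "\<And>x. integral {b..x} \<psi> \<le> K \<Longrightarrow> x \<le> B"
  using bounded_of_divergent_integral[OF \<psi>_cont _ keller_osserman assms] by auto

text \<open>
  A pair of profiles is a family indexed by \<open>1\<close> and \<open>2\<close>, like the data of the system.
\<close>
definition rhs :: "(nat \<Rightarrow> real \<Rightarrow> real) \<Rightarrow> nat \<Rightarrow> real \<Rightarrow> real" where
  "rhs u j r = a j r * f j (u 1 r, u 2 r)"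

abbreviation slopes :: "(nat \<Rightarrow> real \<Rightarrow> real) \<Rightarrow> nat \<Rightarrow> real \<Rightarrow> real" where
  "slopes u j \<equiv> slope (N - 1) p (h j) (rhs u j)"

definition nonneg_profiles :: "(nat \<Rightarrow> real \<Rightarrow> real) \<Rightarrow> bool" where
  "nonneg_profiles u \<longleftrightarrow> (\<forall>j\<in>{1, 2}. continuous_on {0..} (u j) \<and> (\<forall>r\<ge>0. u j r \<ge> 0))"

lemma rhs_nonneg: "nonneg_profiles u \<Longrightarrow> j \<in> {1, 2} \<Longrightarrow> r \<ge> 0 \<Longrightarrow> rhs u j r \<ge> 0"
  unfolding rhs_def nonneg_profiles_def using a f_nonneg by auto

lemma rhs_cont:
  assumes "nonneg_profiles u" "j \<in> {1, 2}" shows "continuous_on {0..} (rhs u j)"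
proof -
  have "continuous_on {0..} (\<lambda>r. f j (u 1 r, u 2 r))"
    by (rule continuous_on_compose2[of "{0..} \<times> {0..}" "f j"])
       (use f[OF assms(2)] assms(1) in \<open>auto intro!: continuous_intros simp: nonneg_profiles_def\<close>)
  then show ?thesis unfolding rhs_def using a[OF assms(2)] by (intro continuous_intros) auto
qed

lemma energy_estimate_system:
  assumes u: "nonneg_profiles u" and j: "j \<in> {1, 2}"
    and R: "0 \<le> R" "R \<le> r"
    and \<Gamma>: "\<Gamma> \<ge> 0"
      "\<And>s. R < s \<Longrightarrow> s < r \<Longrightarrow> weight (N - 1) (h j) s powr (p / (p - 1)) * a j s \<le> \<Gamma>"
    and U: "continuous_on {R..r} U" "\<And>s. R \<le> s \<Longrightarrow> s \<le> r \<Longrightarrow> U s > 0"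
    and U': "\<And>s. R < s \<Longrightarrow> s < r \<Longrightarrow> (U has_real_derivative U' s) (at s)"
    and u_le: "\<And>s i. R < s \<Longrightarrow> s < r \<Longrightarrow> i \<in> {1, 2} \<Longrightarrow> u i s \<le> U s"
    and slope_le: "\<And>s. R < s \<Longrightarrow> s < r \<Longrightarrow> slopes u j s \<le> U' s"
  shows "slopes u j r powr p * weight (N - 1) (h j) r powr (p / (p - 1)) \<le>
    flux (N - 1) (h j) (rhs u j) R powr (p / (p - 1)) + p / (p - 1) * \<Gamma> * F (U r)"
proof -
  interpret E: radial_operator "N - 1" p "h j" by (rule operator[OF j])
  have "flux (N - 1) (h j) (rhs u j) r powr (p / (p - 1)) \<le>
    flux (N - 1) (h j) (rhs u j) R powr (p / (p - 1)) + p / (p - 1) * \<Gamma> * F (U r)"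
    unfolding rhs_def
  proof (rule E.energy_estimate[where a = "a j" and \<phi> = "\<lambda>s. f j (u 1 s, u 2 s)" and F = F
        and G = diag and U = U and U' = U' and \<Gamma> = \<Gamma> and R = R and r = r])
    show "continuous_on {0..} (\<lambda>s. a j s * f j (u 1 s, u 2 s))"
      using rhs_cont[OF u j] by (simp add: rhs_def[abs_def])
    show "f j (u 1 s, u 2 s) \<ge> 0" if "s \<ge> 0" for s
      using u that by (intro f_nonneg[OF j]) (auto simp: nonneg_profiles_def)
    show "f j (u 1 s, u 2 s) \<le> diag (U s)" if "R < s" "s < r" for s
      using u that R u_le[OF that] by (intro f_le_diag[OF j]) (auto simp: nonneg_profiles_def)
    show "slope (N - 1) p (h j) (\<lambda>s. a j s * f j (u 1 s, u 2 s)) s \<le> U' s" if "R < s" "s < r" for s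
      using slope_le[OF that] by (simp add: rhs_def[abs_def])
    show "F x \<ge> 0" if "x > 0" for x using F_pos[OF that] by simp
  qed (use a[OF j] R \<Gamma> U U' F_deriv in auto)
  moreover have "slopes u j r powr p * weight (N - 1) (h j) r powr (p / (p - 1))
      \<le> flux (N - 1) (h j) (rhs u j) r powr (p / (p - 1))"
    unfolding E.slope_powr by (cases "weight (N - 1) (h j) r powr (p / (p - 1)) = 0") simp_all
  ultimately show ?thesis by linarith
qed

lemma solution_iff:
  "positive_entire_radial_solution N p h a f (u 1) (u 2) \<longleftrightarrow>
    (\<forall>j\<in>{1, 2}. (\<forall>r\<ge>0. u j r > 0) \<and>
      (\<forall>r\<ge>0. (u j has_real_derivative slopes u j r) (at r within {0..})))"
  (is "?L \<longleftrightarrow> ?R")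
proof -
  have eq: "?L \<longleftrightarrow> (\<forall>j\<in>{1, 2}. positive_radial_solution N p (h j) (rhs u j) (u j))"
    by (simp add: positive_entire_radial_solution_def rhs_def[abs_def])
  have SucN: "Suc (N - 1) = N" using N by simp
  have L: "nonneg_profiles u" if ?L
    unfolding nonneg_profiles_def
  proof
    fix j :: nat assume "j \<in> {1, 2}"
    then have "positive_radial_solution N p (h j) (rhs u j) (u j)" using that eq by blast
    then show "continuous_on {0..} (u j) \<and> (\<forall>r\<ge>0. u j r \<ge> 0)"
      unfolding positive_radial_solution_def by (auto intro!: DERIV_continuous_on less_imp_le)
  qed
  have R: "nonneg_profiles u" if ?R
    unfolding nonneg_profiles_def
  proof
    fix j :: nat assume "j \<in> {1, 2}"
    then show "continuous_on {0..} (u j) \<and> (\<forall>r\<ge>0. u j r \<ge> 0)"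
      using that by (auto intro!: DERIV_continuous_on less_imp_le)
  qed
  have "positive_radial_solution N p (h j) (rhs u j) (u j) \<longleftrightarrow> (\<forall>r\<ge>0. u j r > 0) \<and>
      (\<forall>r\<ge>0. (u j has_real_derivative slopes u j r) (at r within {0..}))"
    if "nonneg_profiles u" and j: "j \<in> {1, 2}" for j
  proof -
    interpret E: radial_operator "N - 1" p "h j" by (rule operator[OF j])
    note c = rhs_cont[OF that] rhs_nonneg[OF that]
    have "\<forall>r\<ge>0. u j r > 0" if "positive_radial_solution N p (h j) (rhs u j) (u j)"
      using that by (simp add: positive_radial_solution_def)
    then show ?thesis
      using E.positive_radial_solution_of_slope[OF c, of "u j"]
        E.slope_of_positive_radial_solution[OF c, of "u j"]
      unfolding SucN by blast
  qed
  then show ?thesis using L R eq by (metis (no_types, lifting))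
qed

lemma slopes_cont:
  assumes "nonneg_profiles u" "j \<in> {1, 2}" shows "continuous_on {0..} (slopes u j)"
  by (rule radial_operator.slope_cont[OF operator[OF assms(2)] rhs_cont[OF assms] rhs_nonneg[OF assms]])

lemma slopes_nonneg: "slopes u j r \<ge> 0"
  by (simp add: slope_def)

lemma slopes_mono:
  assumes u: "nonneg_profiles u" and w: "nonneg_profiles w" and j: "j \<in> {1, 2}" and r: "r \<ge> 0"
    and le: "\<And>i s. i \<in> {1, 2} \<Longrightarrow> 0 \<le> s \<Longrightarrow> u i s \<le> w i s"
  shows "slopes u j r \<le> slopes w j r"
proof (rule radial_operator.slope_mono[OF operator[OF j] rhs_cont[OF u j] rhs_cont[OF w j] r])
  show "rhs u j s \<le> rhs w j s" if "0 \<le> s" for s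
    unfolding rhs_def using that u a[OF j] le[of 1 s] le[of 2 s]
    by (intro mult_left_mono f_mono[OF j]) (auto simp: nonneg_profiles_def)
qed (use rhs_nonneg[OF u j] in auto)

text \<open>
  If both slopes satisfy \<open>u\<^sub>j'\<^sup>p \<le> k F(U)\<close> and \<open>U'\<close> is their sum, then \<open>U' \<psi>(U) \<le> 2 k\<^bsup>1/p\<^esup>\<close>.
\<close>
lemma integral_\<psi>_le:
  assumes u: "nonneg_profiles u" and R: "0 \<le> R" "R \<le> r" and b: "b > 0"
    and U: "continuous_on {R..r} U" "\<And>s. R \<le> s \<Longrightarrow> s \<le> r \<Longrightarrow> U s > b"
    and U': "\<And>s. R < s \<Longrightarrow> s < r \<Longrightarrow> (U has_real_derivative slopes u 1 s + slopes u 2 s) (at s)"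
    and k: "continuous_on {R..r} k" "\<And>s. R \<le> s \<Longrightarrow> s \<le> r \<Longrightarrow> k s \<ge> 0"
    and le: "\<And>j s. j \<in> {1, 2} \<Longrightarrow> R < s \<Longrightarrow> s < r \<Longrightarrow> slopes u j s powr p \<le> k s * F (U s)"
  shows "integral {b..U r} \<psi> \<le> integral {b..U R} \<psi> + integral {R..r} (\<lambda>s. 2 * k s powr (1 / p))"
proof (rule separation_of_variables[OF R(2) _ U U'])
  show "continuous_on {b..} \<psi>" using b by (intro continuous_on_subset[OF \<psi>_cont]) auto
  show "continuous_on {R..r} (\<lambda>s. 2 * k s powr (1 / p))"
    using p1 k(2) by (intro continuous_on_mult_left continuous_on_powr' k(1) continuous_on_const) auto
  fix s assume s: "R < s" "s < r"
  have U0: "U s > 0" using U(2)[of s] b s by simp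
  have "slopes u j s * \<psi> (U s) \<le> k s powr (1 / p)" if j: "j \<in> {1, 2}" for j
  proof -
    have "slopes u j s = (slopes u j s powr p) powr (1 / p)"
      using p1 slopes_nonneg[of j u s] by (simp add: powr_powr)
    also have "\<dots> \<le> (k s * F (U s)) powr (1 / p)"
      using p1 by (intro powr_mono2 le[OF j s]) auto
    also have "\<dots> = k s powr (1 / p) * F (U s) powr (1 / p)" by (rule powr_mult)
    finally have "slopes u j s * \<psi> (U s) \<le> k s powr (1 / p) * F (U s) powr (1 / p) * \<psi> (U s)"
      by (intro mult_right_mono) auto
    then show ?thesis using F_root_\<psi>[OF U0] by (simp add: mult.assoc)
  qed
  from this[of 1] this[of 2] show "(slopes u 1 s + slopes u 2 s) * \<psi> (U s) \<le> 2 * k s powr (1 / p)"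
    by (simp add: distrib_right)
qed auto

section \<open>Existence by monotone iteration\<close>

primrec iterate :: "real \<Rightarrow> nat \<Rightarrow> nat \<Rightarrow> real \<Rightarrow> real" where
  "iterate b 0 = (\<lambda>j r. b)"
| "iterate b (Suc k) = (\<lambda>j r. b + integral {0..r} (slopes (iterate b k) j))"

lemma iterate_step:
  assumes "nonneg_profiles (iterate b k)" "j \<in> {1, 2}" "r \<ge> 0"
  shows "(iterate b (Suc k) j has_real_derivative slopes (iterate b k) j r) (at r within {0..})"
    and "iterate b (Suc k) j r \<ge> b"
proof -
  note c = slopes_cont[OF assms(1,2)]
  show "(iterate b (Suc k) j has_real_derivative slopes (iterate b k) j r) (at r within {0..})"
    using has_real_derivative_integral_atLeast[OF c assms(3)] 
    by (auto intro!: derivative_eq_intros)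
  have "integral {0..r} (slopes (iterate b k) j) \<ge> 0"
    by (intro integral_nonneg integrable_continuous_real continuous_on_subset[OF c] slopes_nonneg) auto
  then show "iterate b (Suc k) j r \<ge> b" by simp
qed

lemma iterate_profiles: "b > 0 \<Longrightarrow> nonneg_profiles (iterate b k)"
proof (induction k)
  case 0 then show ?case by (simp add: nonneg_profiles_def)
next
  case (Suc k)
  then have IH: "nonneg_profiles (iterate b k)" by simp
  show ?case
    unfolding nonneg_profiles_def
  proof (intro ballI conjI allI impI)
    fix j :: nat assume j: "j \<in> {1, 2}"
    show "continuous_on {0..} (iterate b (Suc k) j)"
      by (rule DERIV_continuous_on[where D = "slopes (iterate b k) j"]) (use iterate_step(1)[OF IH j] in auto)
    show "iterate b (Suc k) j r \<ge> 0" if "r \<ge> 0" for r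
      using iterate_step(2)[OF IH j that] Suc.prems by linarith
  qed
qed

lemmas iterate_deriv = iterate_step(1)[OF iterate_profiles]

lemma iterate_ge: "b > 0 \<Longrightarrow> j \<in> {1, 2} \<Longrightarrow> r \<ge> 0 \<Longrightarrow> iterate b k j r \<ge> b"
  using iterate_step(2)[OF iterate_profiles] by (cases k) auto

lemma iterate_mono_Suc:
  "b > 0 \<Longrightarrow> j \<in> {1, 2} \<Longrightarrow> r \<ge> 0 \<Longrightarrow> iterate b k j r \<le> iterate b (Suc k) j r"
proof (induction k arbitrary: j r)
  case 0 then show ?case using iterate_ge[of b j r 1] by simp
next
  case (Suc k)
  note pr = iterate_profiles[OF \<open>b > 0\<close>]
  have "integral {0..r} (slopes (iterate b k) j) \<le> integral {0..r} (slopes (iterate b (Suc k)) j)"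
  proof (rule integral_le)
    show "slopes (iterate b k) j s \<le> slopes (iterate b (Suc k)) j s" if "s \<in> {0..r}" for s
      by (rule slopes_mono[OF pr pr]) (use Suc that in auto)
  qed (intro integrable_continuous_real continuous_on_subset[OF slopes_cont[OF pr Suc.prems(2)]]; auto)+
  then show ?case by simp
qed

lemma coefficient_bound: obtains M where "M \<ge> 0" "\<And>j s. j \<in> {1, 2} \<Longrightarrow> 0 \<le> s \<Longrightarrow> s \<le> R \<Longrightarrow> a j s \<le> M"
proof -
  have "\<exists>M. \<forall>s. 0 \<le> s \<and> s \<le> R \<longrightarrow> a j s \<le> M" if "j \<in> {1, 2}" for j
  proof -
    have "bdd_above (a j ` {0..R})"
      by (intro bounded_imp_bdd_above compact_imp_bounded compact_continuous_image)
         (use a[OF that] in \<open>auto intro: continuous_on_subset\<close>)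
    then show ?thesis by (force simp: bdd_above_def)
  qed
  from this[of 1] this[of 2] obtain M1 M2 where
    "\<And>s. 0 \<le> s \<Longrightarrow> s \<le> R \<Longrightarrow> a 1 s \<le> M1" "\<And>s. 0 \<le> s \<Longrightarrow> s \<le> R \<Longrightarrow> a 2 s \<le> M2"
    by (metis insertCI)
  then show ?thesis
    by (intro that[of "max 0 (max M1 M2)"]) (auto simp: le_max_iff_disj)
qed

text \<open>
  The energy inequality for \<open>U = w\<^sub>1 + w\<^sub>2\<close>, where \<open>w\<close> is the iterate after \<open>u\<close>: the derivative of \<open>w\<^sub>j\<close> is
  the slope formed with \<open>f\<^sub>j(u\<^sub>1, u\<^sub>2)\<close>, and \<open>u \<le> w\<close> allows estimating \<open>f\<^sub>j(u\<^sub>1, u\<^sub>2)\<close> through \<open>U\<close>.  As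
  \<open>flux 0 = 0\<close> and the weight is nondecreasing, \<open>w\<^sub>j'\<^sup>p \<le> q M F(U)\<close> with a bound \<open>M\<close> of \<open>a\<^sub>j\<close> on \<open>[0, R]\<close>,
  independently of the iteration step.  Both components start at \<open>b\<close>, so \<open>U \<ge> 2 b > b\<close> and \<open>b\<close> can serve
  as the base point of the integral of \<open>\<psi>\<close>.
\<close>
lemma iterate_bounded:
  assumes b: "b > 0" and R: "R \<ge> 0"
  obtains B where "\<And>k j r. j \<in> {1, 2} \<Longrightarrow> 0 \<le> r \<Longrightarrow> r \<le> R \<Longrightarrow> iterate b k j r \<le> B"
proof -
  define q where "q = p / (p - 1)"
  have q: "q > 0" using p1 by (simp add: q_def)
  obtain M where M: "M \<ge> 0" "\<And>j s. j \<in> {1, 2} \<Longrightarrow> 0 \<le> s \<Longrightarrow> s \<le> R \<Longrightarrow> a j s \<le> M"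
    using coefficient_bound[of R] by blast
  obtain B where B: "\<And>x. integral {b..x} \<psi> \<le> integral {b..2*b} \<psi> + R * (2 * (q * M) powr (1 / p)) \<Longrightarrow> x \<le> B"
    using bounded_of_integral_\<psi>[OF b] by blast
  have "iterate b k j r \<le> B" if j: "j \<in> {1, 2}" and r: "0 \<le> r" "r \<le> R" for k j r
  proof -
    let ?u = "iterate b k" and ?w = "iterate b (Suc k)"
    note pr = iterate_profiles[OF b, of k] iterate_profiles[OF b, of "Suc k"]
    define U where "U = (\<lambda>s. ?w 1 s + ?w 2 s)"
    have U_cont: "continuous_on {0..} U"
      unfolding U_def using pr(2) by (intro continuous_intros) (auto simp: nonneg_profiles_def)
    have U_ge: "U s \<ge> 2 * b" if "s \<ge> 0" for s
      using iterate_ge[OF b, of 1 s "Suc k"] iterate_ge[OF b, of 2 s "Suc k"] that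
      unfolding U_def by (simp del: iterate.simps)
    have w_le_U: "?w i s \<le> U s" if "i \<in> {1, 2}" "s \<ge> 0" for i s
      using iterate_ge[OF b, of 1 s "Suc k"] iterate_ge[OF b, of 2 s "Suc k"] that b
      unfolding U_def by (auto simp del: iterate.simps)
    have U_deriv: "(U has_real_derivative slopes ?u 1 s + slopes ?u 2 s) (at s)" if "s > 0" for s
    proof -
      have "(?w i has_real_derivative slopes ?u i s) (at s)" if "i \<in> {1, 2}" for i
        using iterate_deriv[OF b that, of s k] \<open>s > 0\<close>
        by (intro has_real_derivative_within_atLeast_at[of _ _ s 0]) auto
      then show ?thesis unfolding U_def by (intro DERIV_add) auto
    qed
    have "integral {b..U r} \<psi> \<le> integral {b..U 0} \<psi> + integral {0..r} (\<lambda>s. 2 * (q * M) powr (1 / p))"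
    proof (rule integral_\<psi>_le[OF pr(1) _ r(1) b])
      show "continuous_on {0..r} U" using U_cont by (rule continuous_on_subset) auto
      show "b < U s" if "0 \<le> s" for s using U_ge[OF that] b by simp
      fix i s assume i: "i \<in> {1, 2::nat}" and s: "0 < s" "s < r"
      interpret E: radial_operator "N - 1" p "h i" by (rule operator[OF i])
      let ?P = "weight (N - 1) (h i) s powr q"
      have Pp: "?P > 0" using E.weight_pos[of s] s by simp
      have "slopes ?u i s powr p * ?P \<le> flux (N - 1) (h i) (rhs ?u i) 0 powr q + q * (?P * M) * F (U s)"
        unfolding q_def
      proof (rule energy_estimate_system[OF pr(1) i, where U' = "\<lambda>s. slopes ?u 1 s + slopes ?u 2 s"])
        show "continuous_on {0..s} U" using U_cont by (rule continuous_on_subset) auto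
        fix t assume t: "0 < t" "t < s"
        show "weight (N - 1) (h i) t powr (p / (p - 1)) * a i t \<le> weight (N - 1) (h i) s powr (p / (p - 1)) * M"
          using t s r q E.weight_mono[of t s] E.weight_nonneg[of t] a[OF i] 
          by (intro mult_mono powr_mono2 M(2)[OF i]) (auto simp: q_def)
        show "iterate b k l t \<le> U t" if "l \<in> {1, 2}" for l
          using iterate_mono_Suc[OF b that, of t k] w_le_U[OF that, of t] t by simp
        show "slopes ?u i t \<le> slopes ?u 1 t + slopes ?u 2 t"
          using i slopes_nonneg[of 1 ?u t] slopes_nonneg[of 2 ?u t] by auto
      qed (use s M U_ge b U_deriv in \<open>auto intro: less_le_trans[of 0 "2*b"]\<close>)
      also have "\<dots> = (q * M * F (U s)) * ?P" by simp
      finally show "slopes ?u i s powr p \<le> q * M * F (U s)" using Pp by simp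
    qed (use q M U_deriv in auto)
    then have "integral {b..U r} \<psi> \<le> integral {b..U 0} \<psi> + r * (2 * (q * M) powr (1 / p))"
      using r by simp
    also have "\<dots> \<le> integral {b..2*b} \<psi> + R * (2 * (q * M) powr (1 / p))"
      using r by (intro add_mono mult_right_mono) (auto simp: U_def)
    finally have "U r \<le> B" by (rule B)
    then show ?thesis using iterate_mono_Suc[OF b j r(1), of k] w_le_U[OF j r(1)] by simp
  qed
  then show ?thesis by (rule that)
qed

lemma f_tendsto:
  assumes "j \<in> {1, 2}" and "x \<longlonglongrightarrow> s" "y \<longlonglongrightarrow> t" and "\<And>k. x k \<ge> 0" "\<And>k. y k \<ge> 0"
  shows "(\<lambda>k. f j (x k, y k)) \<longlonglongrightarrow> f j (s, t)"
proof (rule continuous_on_tendsto_compose[of "{0..} \<times> {0..}" "f j"])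
  show "continuous_on ({0..} \<times> {0..}) (f j)" using f assms by auto
  show "(\<lambda>k. (x k, y k)) \<longlonglongrightarrow> (s, t)" by (intro tendsto_intros assms)
  show "(s, t) \<in> {0..} \<times> {0..}"
    using LIMSEQ_le_const[OF assms(2)] LIMSEQ_le_const[OF assms(3)] assms(4,5) by auto
qed (use assms in auto)

text \<open>
  Dominated convergence is used twice: for the flux at each point, with the bound \<open>M (f\<^sub>1 + f\<^sub>2)(B, B)\<close> on the
  right-hand sides, and then for the slopes, which this bound also controls.  Of \<open>w\<close> only the pointwise
  convergence is known at this stage: its continuity will follow from the conclusion.
\<close>
lemma slopes_limit:
  assumes u: "\<And>k. nonneg_profiles (u k)" and j: "j \<in> {1, 2}"
    and lim: "\<And>i s. i \<in> {1, 2} \<Longrightarrow> 0 \<le> s \<Longrightarrow> (\<lambda>k. u k i s) \<longlonglongrightarrow> w i s"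
    and bound: "\<And>k i s. i \<in> {1, 2} \<Longrightarrow> 0 \<le> s \<Longrightarrow> s \<le> R \<Longrightarrow> u k i s \<le> B"
    and R: "R \<ge> 0"
  shows "slopes w j integrable_on {0..R}"
    and "(\<lambda>k. integral {0..R} (slopes (u k) j)) \<longlonglongrightarrow> integral {0..R} (slopes w j)"
proof -
  interpret E: radial_operator "N - 1" p "h j" by (rule operator[OF j])
  obtain M where M: "M \<ge> 0" "\<And>j s. j \<in> {1, 2} \<Longrightarrow> 0 \<le> s \<Longrightarrow> s \<le> R \<Longrightarrow> a j s \<le> M"
    using coefficient_bound[of R] by blast
  let ?C = "M * diag B"
  have u0: "u k i s \<ge> 0" if "i \<in> {1, 2}" "s \<ge> 0" for k i s
    using u that by (auto simp: nonneg_profiles_def)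
  have "B \<ge> 0" using u0[of 1 0 0] bound[of 1 0 0] R by auto
  have rhs_le: "rhs (u k) j s \<le> ?C" if "0 \<le> s" "s \<le> R" for k s
    unfolding rhs_def using that u0 bound a[OF j] M
    by (intro mult_mono f_le_diag[OF j] M(2)[OF j] f_nonneg[OF j]) auto
  have C: "?C \<ge> 0" using rhs_le[of 0 0] rhs_nonneg[OF u j, of 0 0] R by linarith
  have rhs_lim: "(\<lambda>k. rhs (u k) j s) \<longlonglongrightarrow> rhs w j s" if "s \<ge> 0" for s
    unfolding rhs_def using that by (intro tendsto_intros f_tendsto[OF j] lim u0) auto
  have flux_lim: "(\<lambda>k. flux (N - 1) (h j) (rhs (u k) j) r) \<longlonglongrightarrow> flux (N - 1) (h j) (rhs w j) r"
    if r: "0 \<le> r" "r \<le> R" for r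
    unfolding flux_def
  proof (rule dominated_convergence(2))
    show "(\<lambda>s. weight (N - 1) (h j) s * rhs (u k) j s) integrable_on {0..r}" for k
      by (rule E.weighted_integrable[OF rhs_cont[OF u j]])
    show "(\<lambda>s. weight (N - 1) (h j) r * ?C) integrable_on {0..r}" by (rule integrable_const_ivl)
    fix s assume s: "s \<in> {0..r}"
    show "norm (weight (N - 1) (h j) s * rhs (u k) j s) \<le> weight (N - 1) (h j) r * ?C" for k
      using s r E.weight_mono[of s r] E.weight_nonneg[of s] E.weight_nonneg[of r] rhs_le[of s k] rhs_nonneg[OF u j, of s k]
      by (auto simp: abs_mult intro!: mult_mono)
    show "(\<lambda>k. weight (N - 1) (h j) s * rhs (u k) j s) \<longlonglongrightarrow> weight (N - 1) (h j) s * rhs w j s"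
      using s by (intro tendsto_intros rhs_lim) auto
  qed
  have slope_lim: "(\<lambda>k. slopes (u k) j r) \<longlonglongrightarrow> slopes w j r" if r: "0 \<le> r" "r \<le> R" for r
  proof (cases "r = 0")
    case False
    have "(\<lambda>k. flux (N - 1) (h j) (rhs (u k) j) r / weight (N - 1) (h j) r)
      \<longlonglongrightarrow> flux (N - 1) (h j) (rhs w j) r / weight (N - 1) (h j) r"
      using E.weight_pos[of r] False r by (intro tendsto_divide flux_lim tendsto_const r) auto
    then show ?thesis
      unfolding slope_def using p1 r
      by (intro tendsto_powr2 tendsto_const always_eventually allI divide_nonneg_nonneg
          E.flux_nonneg[OF rhs_nonneg[OF u j]] E.weight_nonneg) auto
  qed simp
  have slope_le: "slopes (u k) j r \<le> (?C * R) powr (1 / (p - 1))" if r: "0 \<le> r" "r \<le> R" for k r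
  proof (cases "r = 0")
    case False
    have "flux (N - 1) (h j) (rhs (u k) j) r \<le> weight (N - 1) (h j) r * ?C * r"
      using r rhs_nonneg[OF u j] rhs_le by (intro E.flux_le_weight[OF rhs_cont[OF u j]]) auto
    then have "flux (N - 1) (h j) (rhs (u k) j) r / weight (N - 1) (h j) r \<le> ?C * r"
      using E.weight_pos[of r] False r by (simp add: divide_le_eq mult_ac)
    also have "\<dots> \<le> ?C * R" using r C by (intro mult_left_mono)
    finally show ?thesis
      unfolding slope_def using p1 r
      by (intro powr_mono2 divide_nonneg_nonneg E.flux_nonneg[OF rhs_nonneg[OF u j]] E.weight_nonneg) auto
  qed simp
  have int: "slopes (u k) j integrable_on {0..R}" for k
    by (intro integrable_continuous_real continuous_on_subset[OF slopes_cont[OF u j]]) auto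
  have dom: "norm (slopes (u k) j r) \<le> (?C * R) powr (1 / (p - 1))" if "r \<in> {0..R}" for k r
    using slope_le[of r k] slopes_nonneg[of j "u k" r] that by simp
  note conv = dominated_convergence[OF int integrable_const_ivl dom slope_lim]
  show "slopes w j integrable_on {0..R}" by (rule conv(1)) auto
  show "(\<lambda>k. integral {0..R} (slopes (u k) j)) \<longlonglongrightarrow> integral {0..R} (slopes w j)"
    by (rule conv(2)) auto
qed

lemma solution_exists:
  assumes b: "b > 0"
  obtains u :: "nat \<Rightarrow> real \<Rightarrow> real"
  where "positive_entire_radial_solution N p h a f (u 1) (u 2)" "u 1 0 = b"
proof -
  define u where "u = (\<lambda>j r. lim (\<lambda>k. iterate b k j r))"
  note pr = iterate_profiles[OF b]
  have lim: "(\<lambda>k. iterate b k j r) \<longlonglongrightarrow> u j r" if j: "j \<in> {1, 2}" and r: "0 \<le> r" for j r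
  proof -
    obtain B where B: "\<And>k. iterate b k j r \<le> B" using iterate_bounded[OF b r] j r by (metis order_refl)
    have "incseq (\<lambda>k. iterate b k j r)" by (intro incseq_SucI iterate_mono_Suc[OF b j r])
    then have "convergent (\<lambda>k. iterate b k j r)" using B by (metis incseq_convergent convergentI)
    then show ?thesis unfolding u_def by (simp add: convergent_LIMSEQ_iff)
  qed
  have u_ge: "u j r \<ge> b" if "j \<in> {1, 2}" "0 \<le> r" for j r
    using LIMSEQ_le_const[OF lim[OF that]] iterate_ge[OF b that] by blast
  have int: "slopes u j integrable_on {0..R}" and u_eq: "u j R = b + integral {0..R} (slopes u j)"
    if j: "j \<in> {1, 2}" and R: "0 \<le> R" for j R
  proof -
    obtain B where B: "\<And>k i s. i \<in> {1, 2} \<Longrightarrow> 0 \<le> s \<Longrightarrow> s \<le> R \<Longrightarrow> iterate b k i s \<le> B"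
      using iterate_bounded[OF b R] by blast
    note sl = slopes_limit[of "iterate b", OF pr j lim B R]
    show "slopes u j integrable_on {0..R}" by (rule sl(1))
    have "(\<lambda>k. iterate b (Suc k) j R) \<longlonglongrightarrow> b + integral {0..R} (slopes u j)"
      using tendsto_add[OF tendsto_const[of b] sl(2)] by simp
    then show "u j R = b + integral {0..R} (slopes u j)"
      using LIMSEQ_Suc[OF lim[OF j R]] LIMSEQ_unique by blast
  qed
  have u_cont: "continuous_on {0..} (u j)" if j: "j \<in> {1, 2}" for j
    unfolding continuous_on_eq_continuous_within
  proof
    fix r :: real assume r: "r \<in> {0..}"
    have "continuous_on {0..r+1} (\<lambda>x. b + integral {0..x} (slopes u j))"
      using r by (intro continuous_intros indefinite_integral_continuous_1 int[OF j]) auto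
    then have "continuous_on {0..r+1} (u j)"
      by (rule continuous_on_eq) (use u_eq[OF j] in auto)
    then have "continuous (at r within {0..r+1}) (u j)"
      using r by (simp add: continuous_on_eq_continuous_within)
    moreover have "at r within {0..r+1} = at r within {0..}"
      by (rule at_within_nhd[where S="{..<r+1}"]) auto
    ultimately show "continuous (at r within {0..}) (u j)" by simp
  qed
  have prof: "nonneg_profiles u" using u_cont u_ge b by (force simp: nonneg_profiles_def)
  have deriv: "(u j has_real_derivative slopes u j r) (at r within {0..})"
    if j: "j \<in> {1, 2}" and r: "r \<ge> 0" for j r
  proof (rule has_field_derivative_transform_within[OF _ zero_less_one])
    show "((\<lambda>x. b + integral {0..x} (slopes u j)) has_real_derivative slopes u j r) (at r within {0..})"
      using has_real_derivative_integral_atLeast[OF slopes_cont[OF prof j] r]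
      by (auto intro!: derivative_eq_intros)
  qed (use u_eq[OF j] r in auto)
  have "u j r > 0" if "j \<in> {1, 2}" "r \<ge> 0" for j r using u_ge[OF that] b by linarith
  then have "positive_entire_radial_solution N p h a f (u 1) (u 2)"
    using deriv by (subst solution_iff) blast
  moreover have "u 1 0 = b" using u_eq[of 1 0] by simp
  ultimately show ?thesis by (rule that)
qed

lemma infinite_solutions: "infinite (positive_entire_radial_solutions N p h a f)"
proof
  assume "finite (positive_entire_radial_solutions N p h a f)"
  then have "finite ((\<lambda>(x, y). x 0) ` positive_entire_radial_solutions N p h a f)" by simp
  moreover have "{0<..} \<subseteq> (\<lambda>(x, y). x 0) ` positive_entire_radial_solutions N p h a f"
  proof
    fix b :: real assume "b \<in> {0<..}"
    then obtain u :: "nat \<Rightarrow> real \<Rightarrow> real" where u: "positive_entire_radial_solution N p h a f (u 1) (u 2)" "u 1 0 = b"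
      using solution_exists[of b] by auto
    then have "(restrict (u 1) {0..}, restrict (u 2) {0..}) \<in> positive_entire_radial_solutions N p h a f"
      unfolding positive_entire_radial_solutions_def by blast
    then show "b \<in> (\<lambda>(x, y). x 0) ` positive_entire_radial_solutions N p h a f"
      by (rule rev_image_eqI) (use u in simp)
  qed
  ultimately show False using infinite_Ioi finite_subset by blast
qed

section \<open>Bounded and large solutions\<close>

lemma solution_profiles:
  assumes "positive_entire_radial_solution N p h a f (u 1) (u 2)"
  shows "nonneg_profiles u"
    and "\<And>j r. j \<in> {1, 2} \<Longrightarrow> r \<ge> 0 \<Longrightarrow> u j r > 0"
    and "\<And>j r. j \<in> {1, 2} \<Longrightarrow> r \<ge> 0 \<Longrightarrow> (u j has_real_derivative slopes u j r) (at r within {0..})"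
    and "\<And>j s r. j \<in> {1, 2} \<Longrightarrow> 0 \<le> s \<Longrightarrow> s \<le> r \<Longrightarrow> u j s \<le> u j r"
proof -
  have sol: "\<forall>j\<in>{1, 2}. (\<forall>r\<ge>0. u j r > 0) \<and>
      (\<forall>r\<ge>0. (u j has_real_derivative slopes u j r) (at r within {0..}))"
    using assms by (subst (asm) solution_iff)
  show pos: "\<And>j r. j \<in> {1, 2} \<Longrightarrow> r \<ge> 0 \<Longrightarrow> u j r > 0"
    and deriv: "\<And>j r. j \<in> {1, 2} \<Longrightarrow> r \<ge> 0 \<Longrightarrow> (u j has_real_derivative slopes u j r) (at r within {0..})"
    using sol by blast+
  have cont: "continuous_on {0..} (u j)" if "j \<in> {1, 2}" for j
    by (rule DERIV_continuous_on[where D = "slopes u j"]) (use deriv[OF that] in auto)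
  show "nonneg_profiles u" using cont pos by (auto simp: nonneg_profiles_def intro: less_imp_le)
  fix j :: nat and s r :: real assume j: "j \<in> {1, 2}" and sr: "0 \<le> s" "s \<le> r"
  show "u j s \<le> u j r"
  proof (rule DERIV_nonneg_imp_increasing_open[OF sr(2)])
    fix x assume "s < x" "x < r"
    then show "\<exists>y. (u j has_real_derivative y) (at x) \<and> 0 \<le> y"
      using has_real_derivative_within_atLeast_at[OF deriv[OF j]] slopes_nonneg sr by (meson le_less_trans less_imp_le)
  qed (use cont[OF j] sr in \<open>auto intro: continuous_on_subset\<close>)
qed

definition combined_coefficient :: "real \<Rightarrow> real" where
  "combined_coefficient r = (\<Sum>j\<in>{1, 2}. exp (p / (p - 1) * integral {0..r} (h j)) * a j r)"

lemma combined_coefficient_ge: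
  assumes "j \<in> {1, 2}" "r \<ge> 0"
  shows "exp (p / (p - 1) * integral {0..r} (h j)) * a j r \<le> combined_coefficient r"
  unfolding combined_coefficient_def
  by (rule member_le_sum) (use a assms in auto)

lemma combined_coefficient_nonneg: "r \<ge> 0 \<Longrightarrow> combined_coefficient r \<ge> 0"
  unfolding combined_coefficient_def using a by (intro sum_nonneg mult_nonneg_nonneg) auto

lemma combined_coefficient_cont: "continuous_on {0..} combined_coefficient"
  unfolding combined_coefficient_def
  using a radial_operator.integral_h_cont[OF operator]
  by (intro continuous_on_sum continuous_intros) auto

lemma weight_powr:
  assumes "r > 0"
  shows "weight (N - 1) (h j) r powr (p / (p - 1)) =
    r powr (p * (real N - 1) / (p - 1)) * exp (p / (p - 1) * integral {0..r} (h j))"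
proof -
  have "r ^ (N - 1) = r powr (real N - 1)"
    using N assms powr_realpow[of r "N - 1"] by (simp add: of_nat_diff)
  then have "(r ^ (N - 1)) powr (p / (p - 1)) = r powr (p * (real N - 1) / (p - 1))"
    by (simp add: powr_powr mult.commute)
  then show ?thesis unfolding weight_def powr_mult by (simp add: powr_def)
qed

text \<open>
  The energy inequality is applied on \<open>[R, r]\<close> with \<open>R \<ge> 1\<close> in the range of monotonicity.  The contribution of
  \<open>flux R\<close> is absorbed into a multiple of \<open>F(U)\<close>, since \<open>F(U) \<ge> F(U(0)) > 0\<close>.
\<close>
theorem bounded_solution:
  fixes u :: "nat \<Rightarrow> real \<Rightarrow> real"
  assumes mono: "R1 \<ge> 0" "mono_on {R1..} (\<lambda>r. r powr (p * (real N - 1) / (p - 1)) * combined_coefficient r)"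
    and eps: "\<epsilon> > 0" "(\<integral>\<^sup>+t\<in>{0..}. ennreal (t powr (1 + \<epsilon>) * combined_coefficient t powr (2 / p)) \<partial>lborel) < \<infinity>"
    and sol: "positive_entire_radial_solution N p h a f (u 1) (u 2)"
  shows "bounded_pair (u 1) (u 2)"
proof -
  note u = solution_profiles[OF sol]
  define q where "q = p / (p - 1)"
  define e where "e = p * (real N - 1) / (p - 1)"
  \<comment> \<open>A common decay exponent \<open>1 + \<delta>\<close> for both parts of the root of \<open>k\<close>; \<open>p \<le> N - 1\<close> gives \<open>(N-1)/(p-1) \<ge> 1 + 1/(p-1)\<close>.\<close>
  define \<delta> where "\<delta> = min \<epsilon> (1 / (p - 1))"
  define R where "R = max R1 1"
  \<comment> \<open>Half of \<open>U(0)\<close>, so that \<open>U\<close> stays strictly above the base point of the integral of \<open>\<psi>\<close>.\<close>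
  define b where "b = (u 1 0 + u 2 0) / 2"
  define U where "U = (\<lambda>r. u 1 r + u 2 r)"
  let ?A = combined_coefficient
  have q: "q > 0" using p1 by (simp add: q_def)
  have \<delta>: "\<delta> > 0" using eps p1 by (simp add: \<delta>_def)
  have R: "R \<ge> 1" "R \<ge> R1" by (auto simp: R_def)
  have b: "b > 0" using u(2)[of 1 0] u(2)[of 2 0] by (simp add: b_def)
  have U_ge: "U r \<ge> 2 * b" if "r \<ge> 0" for r
    using u(4)[of 1 0 r] u(4)[of 2 0 r] that by (simp add: U_def b_def)
  have u_le_U: "u i s \<le> U s" if "i \<in> {1, 2}" "s \<ge> 0" for i s
    using u(2)[of 1 s] u(2)[of 2 s] that by (auto simp: U_def)
  have U_mono: "U s \<le> U r" if "0 \<le> s" "s \<le> r" for s r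
    unfolding U_def using that by (intro add_mono u(4)) auto
  have U_cont: "continuous_on {0..} U"
    unfolding U_def using u(1) by (intro continuous_intros) (auto simp: nonneg_profiles_def)
  have U_deriv: "(U has_real_derivative slopes u 1 s + slopes u 2 s) (at s)" if "s > 0" for s
    unfolding U_def using that
    by (intro DERIV_add has_real_derivative_within_atLeast_at[OF u(3)]) auto
  define C where "C = (\<Sum>i\<in>{1, 2}. flux (N - 1) (h i) (rhs u i) R powr q) / F (2 * b)"
  have Fb: "F (2 * b) > 0" using F_pos b by simp
  have C_nonneg: "C \<ge> 0" using Fb by (simp add: C_def)
  define k where "k = (\<lambda>r. C * r powr (- e) + q * ?A r)"
  have k_nonneg: "k r \<ge> 0" if "r \<ge> 0" for r
    using C_nonneg q combined_coefficient_nonneg[OF that] by (simp add: k_def)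
  have key: "slopes u j r powr p \<le> k r * F (U r)" if j: "j \<in> {1, 2}" and r: "R < r" for j r
  proof -
    interpret E: radial_operator "N - 1" p "h j" by (rule operator[OF j])
    let ?P = "weight (N - 1) (h j) r powr q"
    let ?S = "slopes u j r powr p"
    have r0: "r > 0" using r R by simp
    have "?S * ?P \<le> flux (N - 1) (h j) (rhs u j) R powr q + q * (r powr e * ?A r) * F (U r)"
      unfolding q_def
    proof (rule energy_estimate_system[OF u(1) j, where U' = "\<lambda>s. slopes u 1 s + slopes u 2 s"])
      fix t assume t: "R < t" "t < r"
      have "weight (N - 1) (h j) t powr (p / (p - 1)) * a j t
          = t powr e * (exp (p / (p - 1) * integral {0..t} (h j)) * a j t)"
        using weight_powr[of t j] t R by (simp only: e_def mult.assoc)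
      also have "\<dots> \<le> t powr e * ?A t"
        using t R by (intro mult_left_mono combined_coefficient_ge[OF j]) auto
      also have "\<dots> \<le> r powr e * ?A r"
        using t R mono_onD[OF mono(2), of t r] by (simp add: e_def)
      finally show "weight (N - 1) (h j) t powr (p / (p - 1)) * a j t \<le> r powr e * ?A r" .
      show "slopes u j t \<le> slopes u 1 t + slopes u 2 t"
        using j slopes_nonneg[of 1 u t] slopes_nonneg[of 2 u t] by auto
      show "(U has_real_derivative slopes u 1 t + slopes u 2 t) (at t)" using t R by (intro U_deriv) auto
      show "u i t \<le> U t" if "i \<in> {1, 2}" for i using t R that by (intro u_le_U) auto
    next
      show "continuous_on {R..r} U" by (rule continuous_on_subset[OF U_cont]) (use R in auto)
      show "0 < U s" if "R \<le> s" for s using U_ge[of s] b that R by simp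
      show "0 \<le> r powr e * ?A r" using combined_coefficient_nonneg[of r] r0 by simp
    qed (use r R in auto)
    also have "flux (N - 1) (h j) (rhs u j) R powr q \<le> C * F (2 * b)"
      using Fb j unfolding C_def by (auto)
    also have "C * F (2 * b) \<le> C * F (U r)"
      using C_nonneg U_ge[of r] r0 b by (intro mult_left_mono F_mono) auto
    also have "C * F (U r) + q * (r powr e * ?A r) * F (U r) = (k r * F (U r)) * r powr e"
      using r0 by (simp add: k_def algebra_simps powr_minus_divide)
    finally have *: "?S * ?P \<le> (k r * F (U r)) * r powr e" by simp
    have "?P = r powr e * exp (q * integral {0..r} (h j))"
      using weight_powr[OF r0, of j] by (simp add: e_def q_def)
    then have "?P \<ge> r powr e * 1"
      using E.integral_h_nonneg[of r] r0 q by (simp only:) (intro mult_left_mono, auto)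
    then have "?S * r powr e \<le> ?S * ?P" by (intro mult_left_mono) auto
    with * have "?S * r powr e \<le> (k r * F (U r)) * r powr e" by linarith
    then show ?thesis using r0 by simp
  qed
  let ?B = "\<lambda>t. t powr (1 + \<epsilon>) * ?A t powr (2 / p)"
  have B_cont: "continuous_on {0..} ?B"
    using p1 eps combined_coefficient_nonneg
    by (intro continuous_on_mult continuous_on_powr' combined_coefficient_cont continuous_on_const continuous_on_id) auto
  obtain K where K: "\<And>x y. 0 \<le> x \<Longrightarrow> integral {x..y} ?B \<le> K"
    using integral_le_of_nn_integral_finite[OF B_cont _ eps(2)] by auto
  define c1 where "c1 = 2 * ((2 * C) powr (1 / p) + (2 * q) powr (1 / p))"
  define c2 where "c2 = 2 * (2 * q) powr (1 / p)"
  have c: "c1 \<ge> 0" "c2 \<ge> 0" by (auto simp: c1_def c2_def)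
  have k_root: "2 * k t powr (1 / p) \<le> c1 * t powr (- 1 - \<delta>) + c2 * ?B t" if t: "t \<ge> R" for t
  proof -
    have t1: "t \<ge> 1" using t R by simp
    have A0: "?A t \<ge> 0" using combined_coefficient_nonneg[of t] t1 by simp
    let ?x = "?A t powr (1 / p)" and ?T = "t powr (1 + \<epsilon>)"
    have T: "?T > 0" "t powr (- 1 - \<epsilon>) = 1 / ?T"
      using t1 powr_minus_divide[of t "1 + \<epsilon>"] by auto
    have "e / p = (real N - 1) / (p - 1)" using p1 by (simp add: e_def)
    also have "\<dots> \<ge> p / (p - 1)" using p1 pN by (intro divide_right_mono) auto
    also have "p / (p - 1) = 1 + 1 / (p - 1)" using p1 by (simp add: field_simps)
    finally have ep: "e / p \<ge> 1 + \<delta>" by (simp add: \<delta>_def min_le_iff_disj)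
    have "k t powr (1 / p) \<le> (2 * (C * t powr (- e))) powr (1 / p) + (2 * (q * ?A t)) powr (1 / p)"
      unfolding k_def using C_nonneg q A0 p1 by (intro powr_add_le) auto
    also have "(2 * (C * t powr (- e))) powr (1 / p) = (2 * C) powr (1 / p) * t powr (- (e / p))"
      by (simp add: powr_mult powr_powr)
    also have "\<dots> \<le> (2 * C) powr (1 / p) * t powr (- 1 - \<delta>)"
      using ep t1 by (intro mult_left_mono powr_mono) auto
    also have "(2 * (q * ?A t)) powr (1 / p) = (2 * q) powr (1 / p) * ?x"
      by (simp add: powr_mult)
    also have "?x \<le> t powr (- 1 - \<delta>) + ?B t"
    proof -
      have sq: "?A t powr (2 / p) = ?x * ?x" by (simp flip: powr_add)
      \<comment> \<open>According to whether \<open>T x \<le> 1\<close>, the first or the second summand alone dominates \<open>x\<close>.\<close>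
      have "?x \<le> 1 / ?T + ?T * (?x * ?x)"
      proof (cases "?T * ?x \<le> 1")
        case True
        then have "?x \<le> 1 / ?T" using T by (simp add: field_simps)
        moreover have "0 \<le> ?T * (?x * ?x)" by simp
        ultimately show ?thesis by linarith
      next
        case False
        then have "1 * ?x \<le> (?T * ?x) * ?x" by (intro mult_right_mono) auto
        then have "?x \<le> ?T * (?x * ?x)" by (simp only: mult_1 mult.assoc)
        moreover have "0 \<le> 1 / ?T" by simp
        ultimately show ?thesis by linarith
      qed
      moreover have "1 / ?T \<le> t powr (- 1 - \<delta>)"
        unfolding T(2)[symmetric] using t1 by (intro powr_mono) (auto simp: \<delta>_def)
      ultimately show ?thesis by (simp add: sq)
    qed
    finally have "k t powr (1 / p) \<le> (2 * C) powr (1 / p) * t powr (- 1 - \<delta>)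
        + (2 * q) powr (1 / p) * (t powr (- 1 - \<delta>) + ?B t)"
      by (simp add: mult_left_mono)
    then show ?thesis by (simp add: c1_def c2_def algebra_simps)
  qed
  have k_cont: "continuous_on {R..r} k" for r
    unfolding k_def using R
    by (intro continuous_on_add continuous_on_mult continuous_on_powr continuous_on_const continuous_on_id
        continuous_on_subset[OF combined_coefficient_cont]) auto
  define J where "J = R powr (- \<delta>) / \<delta>"
  have powr_int: "((\<lambda>x. x powr (- 1 - \<delta>)) has_integral J) {R..}"
    using has_integral_powr_to_inf[of "- 1 - \<delta>" R] \<delta> R by (simp add: J_def)
  have int_le: "integral {R..r} (\<lambda>s. 2 * k s powr (1 / p)) \<le> c1 * J + c2 * K" if r: "R \<le> r" for r
  proof -
    have i1: "(\<lambda>x. x powr (- 1 - \<delta>)) integrable_on {R..r}"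
      using R by (intro integrable_continuous_real continuous_intros) auto
    have i2: "?B integrable_on {R..r}"
      using R by (intro integrable_continuous_real continuous_on_subset[OF B_cont]) auto
    have "integral {R..r} (\<lambda>s. 2 * k s powr (1 / p)) 
        \<le> integral {R..r} (\<lambda>t. c1 * t powr (- 1 - \<delta>) + c2 * ?B t)"
    proof (rule integral_le)
      have "continuous_on {R..r} (\<lambda>s. k s powr (1 / p))"
        using p1 R k_nonneg by (intro continuous_on_powr' k_cont continuous_on_const) auto
      then show "(\<lambda>s. 2 * k s powr (1 / p)) integrable_on {R..r}"
        by (intro integrable_continuous_real continuous_on_mult_left)
      show "(\<lambda>t. c1 * t powr (- 1 - \<delta>) + c2 * ?B t) integrable_on {R..r}"
        by (intro integrable_add integrable_on_mult_right i1 i2)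
    qed (use k_root in auto)
    also have "\<dots> = c1 * integral {R..r} (\<lambda>x. x powr (- 1 - \<delta>)) + c2 * integral {R..r} ?B"
      using i1 i2
      by (subst integral_add) (auto intro: integrable_on_mult_right)
    also have "integral {R..r} (\<lambda>x. x powr (- 1 - \<delta>)) \<le> integral {R..} (\<lambda>x. x powr (- 1 - \<delta>))"
      using powr_int by (intro integral_subset_le i1) (auto simp: has_integral_iff)
    also have "\<dots> = J" using powr_int by (rule integral_unique)
    also have "integral {R..r} ?B \<le> K" using R by (intro K) auto
    finally show ?thesis using c by (simp add: mult_left_mono)
  qed
  obtain B where B: "\<And>x. integral {b..x} \<psi> \<le> integral {b..U R} \<psi> + (c1 * J + c2 * K) \<Longrightarrow> x \<le> B"
    using bounded_of_integral_\<psi>[OF b] by blast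
  have "U r \<le> B" if r: "r \<ge> R" for r
  proof (rule B)
    have "integral {b..U r} \<psi> \<le> integral {b..U R} \<psi> + integral {R..r} (\<lambda>s. 2 * k s powr (1 / p))"
    proof (rule integral_\<psi>_le[OF u(1) _ r b])
      show "b < U s" if "R \<le> s" for s using U_ge[of s] that R b by simp
      show "continuous_on {R..r} U" using R by (intro continuous_on_subset[OF U_cont]) auto
    qed (use R U_deriv k_cont k_nonneg key in auto)
    then show "integral {b..U r} \<psi> \<le> integral {b..U R} \<psi> + (c1 * J + c2 * K)"
      using int_le[OF r] by linarith
  qed
  then have UB: "U r \<le> B" if "r \<ge> 0" for r
    using U_mono[OF that, of "max r R"] by (metis max.cobounded1 max.cobounded2 order_trans)
  have "bounded (u j ` {0..})" if j: "j \<in> {1, 2}" for j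
    unfolding bounded_iff
  proof (intro exI[of _ B] ballI)
    fix y assume "y \<in> u j ` {0..}"
    then obtain r where "r \<ge> 0" "y = u j r" by auto
    then show "norm y \<le> B" using u(2)[OF j, of r] u_le_U[OF j, of r] UB[of r] by simp
  qed
  then show ?thesis by (simp add: bounded_pair_def)
qed

theorem large_solution:
  fixes u :: "nat \<Rightarrow> real \<Rightarrow> real"
  assumes inf: "\<And>j. j \<in> {1, 2} \<Longrightarrow> (\<integral>\<^sup>+t\<in>{0..}. ennreal (slope (N - 1) p (h j) (a j) t) \<partial>lborel) = \<infinity>"
    and sol: "positive_entire_radial_solution N p h a f (u 1) (u 2)"
  shows "large_pair (u 1) (u 2)"
proof -
  note u = solution_profiles[OF sol]
  have "filterlim (u j) at_top at_top" if j: "j \<in> {1, 2}" for j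
  proof -
    interpret E: radial_operator "N - 1" p "h j" by (rule operator[OF j])
    let ?s = "slope (N - 1) p (h j) (a j)"
    have aj: "continuous_on {0..} (a j)" "\<And>r. r \<ge> 0 \<Longrightarrow> a j r \<ge> 0" using a[OF j] by auto
    define c where "c = f j (u 1 0, u 2 0)"
    have c: "c > 0" unfolding c_def using u(2) by (intro f_pos[OF j]) auto
    have s_cont: "continuous_on {0..} ?s" by (rule E.slope_cont[OF aj])
    have le: "c powr (1 / (p - 1)) * ?s r \<le> slopes u j r" if "r \<ge> 0" for r
      unfolding E.slope_cmult[OF less_imp_le[OF c], symmetric]
    proof (rule E.slope_mono[OF _ rhs_cont[OF u(1) j] that])
      show "c * a j s \<le> rhs u j s" if "0 \<le> s" for s
        unfolding rhs_def c_def mult.commute[of "a j s"] using that aj u(4) u(2)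
        by (intro mult_right_mono f_mono[OF j]) (auto intro: less_imp_le)
    qed (use aj c in \<open>auto intro!: continuous_intros\<close>)
    have "u j 0 + c powr (1 / (p - 1)) * integral {0..r} ?s \<le> u j r" if r: "r \<ge> 0" for r
    proof -
      have i1: "(slopes u j has_integral (u j r - u j 0)) {0..r}"
        by (rule fundamental_theorem_of_calculus[OF r])
           (use DERIV_subset[OF u(3)[OF j]] in \<open>auto simp flip: has_real_derivative_iff_has_vector_derivative\<close>)
      have "(?s has_integral integral {0..r} ?s) {0..r}"
        by (intro integrable_integral integrable_continuous_real continuous_on_subset[OF s_cont]) auto
      then have "((\<lambda>t. c powr (1 / (p - 1)) * ?s t) has_integral c powr (1 / (p - 1)) * integral {0..r} ?s) {0..r}"
        by (rule has_integral_mult_right)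
      from has_integral_le[OF this i1] le show ?thesis by simp
    qed
    then have "\<forall>\<^sub>F r in at_top. u j 0 + c powr (1 / (p - 1)) * integral {0..r} ?s \<le> u j r"
      by (intro eventually_at_top_linorderI[of 0])
    moreover have "filterlim (\<lambda>r. u j 0 + c powr (1 / (p - 1)) * integral {0..r} ?s) at_top at_top"
      using c
      by (intro filterlim_tendsto_add_at_top[OF tendsto_const] filterlim_tendsto_pos_mult_at_top[OF tendsto_const]
          integral_at_top_of_nn_integral_infinite s_cont inf[OF j] E.slope_nonneg) auto
    ultimately show ?thesis by (rule filterlim_at_top_mono[rotated])
  qed
  then show ?thesis by (simp add: large_pair_def)
qed

end

theorem theorem1p1:
  fixes N :: nat and p :: real
    and a h :: "nat \<Rightarrow> real \<Rightarrow> real"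
    and f :: "nat \<Rightarrow> real \<times> real \<Rightarrow> real"
  assumes "N \<ge> 3" and "1 < p" and "p \<le> real N - 1"
    and "\<And>j. j \<in> {1, 2} \<Longrightarrow>
           continuous_on {0..} (a j) \<and> (\<forall>r\<ge>0. a j r \<ge> 0) \<and> (\<exists>r\<ge>0. a j r \<noteq> 0)"
    and "\<And>j. j \<in> {1, 2} \<Longrightarrow>
           continuous_on {0..} (h j) \<and> (\<forall>r\<ge>0. h j r \<ge> 0) \<and> (\<exists>r\<ge>0. h j r \<noteq> 0)"
    and "\<And>j. j \<in> {1, 2} \<Longrightarrow>
           continuous_on ({0..} \<times> {0..}) (f j) \<and>
           (\<forall>s\<ge>0. \<forall>t\<ge>0. f j (s, t) \<ge> 0) \<and>
           (\<forall>t\<ge>0. mono_on {0..} (\<lambda>s. f j (s, t))) \<and>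
           (\<forall>s\<ge>0. mono_on {0..} (\<lambda>t. f j (s, t))) \<and>
           (\<forall>s\<ge>0. \<forall>t\<ge>0. s > 0 \<or> t > 0 \<longrightarrow> f j (s, t) > 0)"
    and "\<exists>c>0. filterlim (\<lambda>r. integral {c..r} (\<lambda>s. primitive_F f s powr (- 1 / p))) at_top at_top"
  shows "infinite (positive_entire_radial_solutions N p h a f) \<and>
    ((\<exists>R\<ge>0. mono_on {R..} (\<lambda>r. r powr (p * (real N - 1) / (p - 1)) *
         (\<Sum>j\<in>{1, 2}. exp (p / (p - 1) * integral {0..r} (h j)) * a j r))) \<longrightarrow>
      ((\<exists>\<epsilon>>0. (\<integral>\<^sup>+t\<in>{0..}. ennreal (t powr (1 + \<epsilon>) *
             (\<Sum>j\<in>{1, 2}. exp (p / (p - 1) * integral {0..t} (h j)) * a j t) powr (2 / p))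
           \<partial>lborel) < \<infinity>) \<longrightarrow>
        (\<forall>u1 u2. positive_entire_radial_solution N p h a f u1 u2 \<longrightarrow> bounded_pair u1 u2)) \<and>
      ((\<forall>j\<in>{1, 2}. (\<integral>\<^sup>+t\<in>{0..}. ennreal
             ((exp (- integral {0..t} (h j)) / t ^ (N - 1) *
               integral {0..t} (\<lambda>s. s ^ (N - 1) * exp (integral {0..s} (h j)) * a j s))
              powr (1 / (p - 1))) \<partial>lborel) = \<infinity>) \<longrightarrow>
        (\<forall>u1 u2. positive_entire_radial_solution N p h a f u1 u2 \<longrightarrow> large_pair u1 u2)))"
proof -
  interpret quasilinear_system N p a h f
  proof
    fix j :: nat assume j: "j \<in> {1, 2}"
    show "continuous_on {0..} (a j) \<and> (\<forall>r\<ge>0. a j r \<ge> 0)" using assms(4)[OF j] by simp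
    show "continuous_on {0..} (h j) \<and> (\<forall>r\<ge>0. h j r \<ge> 0)" using assms(5)[OF j] by simp
  qed (fact assms)+
  let ?u = "\<lambda>u1 u2 (j::nat). if j = 1 then u1 else u2 :: real \<Rightarrow> real"
  have slope_eq: "(exp (- integral {0..t} (h j)) / t ^ (N - 1) *
      integral {0..t} (\<lambda>s. s ^ (N - 1) * exp (integral {0..s} (h j)) * a j s)) powr (1 / (p - 1))
    = slope (N - 1) p (h j) (a j) t" for j t
    by (simp add: slope_def flux_def weight_def exp_minus divide_simps mult.commute)
  show ?thesis
    unfolding slope_eq
  proof (intro conjI impI allI infinite_solutions; elim exE conjE)
    fix R \<epsilon> :: real and u1 u2 :: "real \<Rightarrow> real"
    assume "R \<ge> 0" "mono_on {R..} (\<lambda>r. r powr (p * (real N - 1) / (p - 1)) *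
         (\<Sum>j\<in>{1, 2}. exp (p / (p - 1) * integral {0..r} (h j)) * a j r))"
      "\<epsilon> > 0" "(\<integral>\<^sup>+t\<in>{0..}. ennreal (t powr (1 + \<epsilon>) *
             (\<Sum>j\<in>{1, 2}. exp (p / (p - 1) * integral {0..t} (h j)) * a j t) powr (2 / p))
           \<partial>lborel) < \<infinity>"
      "positive_entire_radial_solution N p h a f u1 u2"
    then show "bounded_pair u1 u2"
      using bounded_solution[of R \<epsilon> "?u u1 u2"] by (simp only: combined_coefficient_def) simp
  next
    fix u1 u2 :: "real \<Rightarrow> real"
    assume "\<forall>j\<in>{1, 2}. (\<integral>\<^sup>+t\<in>{0..}. ennreal (slope (N - 1) p (h j) (a j) t) \<partial>lborel) = \<infinity>"
      "positive_entire_radial_solution N p h a f u1 u2"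
    then have "large_pair (?u u1 u2 1) (?u u1 u2 2)"
      by (intro large_solution) auto
    then show "large_pair u1 u2" by simp
  qed
qed

end
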